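(* Let $I\times J=[a,b]\times[c,d]\subset\mathbb{R}^2$, $M\in\mathbb{N}\cup\{0\}$, and let $k_1,k_2\in\mathbb{R}$ be such that $y+k_1>0$ and $z-k_2>0$ for all $(y,z)\in I\times J$. Let $P:I\times J\to\mathbb{R}$ be an integrable function, let $\Lambda(h)=\int_a^b\int_c^d P(y,z)h(y,z)\,dz\,dy$, and suppose that $$\int_a^b\int_c^d P(y,z)\frac{(b-y)^i}{i!}\frac{(d-z)^j}{j!}\,dz\,dy=0,\quad i,j\in\{0,\ldots,M\};$$ $$\int_a^s\int_c^d P(y,z)\frac{(s-y)^M}{M!}\frac{(d-z)^j}{j!}\,dz\,dy=0,\quad j\in\{0,\ldots,M\},\ \forall s\in[a,b];$$ $$\int_a^b\int_c^t P(y,z)\frac{(b-y)^i}{i!}\frac{(t-z)^M}{M!}\,dz\,dy=0,\quad i\in\{0,\ldots,M\},\ \forall t\in[c,d];$$ $$\int_a^s\int_c^t P(y,z)\frac{(s-y)^M}{M!}\frac{(t-z)^M}{M!}\,dz\,dy\ge 0,\quad \forall s\in[a,b],\ \forall t\in[c,d].$$ For $q\in\mathbb{R}$ let $$\psi^{(q)}(y,z)=\begin{cases}\dfrac{(y+k_1)^q(z-k_2)^q}{[q(q-1)\cdots(q-M)]^2}, & q\notin\{0,1,\ldots,M\},\\[2mm] \dfrac{(y+k_1)^q(z-k_2)^q\,[\log((y+k_1)(z-k_2))]^2}{2[q!(M-q)!]^2}, & q\in\{0,1,\ldots,M\}.\end{cases}$$ Then: (i) $q\mapsto\Lambda(\psi^{(q)})$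 is continuous on $\mathbb{R}$. (ii) $q\mapsto\Lambda(\psi^{(q)})$ is exponentially convex on $\mathbb{R}$. (iii) If $q\mapsto\Lambda(\psi^{(q)})$ is positive on $\mathbb{R}$, then it is log-convex on $\mathbb{R}$; moreover, for all real $r<s<t$, $$[\Lambda(\psi^{(s)})]^{t-r}\le[\Lambda(\psi^{(r)})]^{t-s}\,[\Lambda(\psi^{(t)})]^{s-r}.$$ (iv) For every $m\in\mathbb{N}$ and $q_1,\ldots,q_m\in\mathbb{R}$, the matrix $\left[\Lambda\big(\psi^{(\frac{q_i+q_j}{2})}\big)\right]_{i,j=1}^m$ is positive semi-definite; in particular its determinant is $\ge 0$. (v) If $q\mapsto\Lambda(\psi^{(q)})$ is differentiable on $\mathbb{R}$, then for all $s,t,u,v\in\mathbb{R}$ with $s\le u$ and $t\le v$, $$\mathfrak{M}_{s,t}\le\mathfrak{M}_{u,v},$$ where $$\mathfrak{M}_{s,t}=\begin{cases}\left(\dfrac{\Lambda(\psi^{(s)})}{\Lambda(\psi^{(t)})}\right)^{\frac{1}{s-t}}, & s\ne t,\\[3mm] \exp\left(\dfrac{\frac{d}{ds}\Lambda(\psi^{(s)})}{\Lambda(\psi^{(s)})}\right), & s=t.\end{cases}$$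
   Context: Convention: $(\cdot)^0=1$. A function $\omega:K\to\mathbb{R}$ on an open interval $K\subset\mathbb{R}$ is exponentially convex if it is continuous and $\sum_{i,j=1}^m\rho_i\rho_j\,\omega(y_i+y_j)\ge 0$ for all $m\in\mathbb{N}$, all $\rho_i\in\mathbb{R}$ and all reals $y_1,\ldots,y_m$ with $y_i+y_j\in K$ for $i,j\in\{1,\ldots,m\}$. A positive function $\omega$ is log-convex if $\omega(\lambda y+(1-\lambda)z)\le\omega(y)^\lambda\omega(z)^{1-\lambda}$ for all $y,z$ in its domain and all $\lambda\in[0,1]$. *)

theory Defs
  imports "Jordan_Normal_Form.Determinant" "HOL-Analysis.Analysis"
begin

(* Iterated Lebesgue integrals. The measure is lebesgue rather than lborel so that integrands which
   are only Lebesgue measurable are covered. Sections of an integrable function may fail to be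
   integrable on a null set of y; the Bochner integral then has the value 0, which does not affect
   the outer integral. *)
definition iterated_integral ::
    "real \<Rightarrow> real \<Rightarrow> real \<Rightarrow> real \<Rightarrow> (real \<times> real \<Rightarrow> real) \<Rightarrow> real" where
  "iterated_integral a b c d f =
     set_lebesgue_integral lebesgue {a..b}
       (\<lambda>y. set_lebesgue_integral lebesgue {c..d} (\<lambda>z. f (y, z)))"

definition Lambda ::
    "real \<Rightarrow> real \<Rightarrow> real \<Rightarrow> real \<Rightarrow> (real \<times> real \<Rightarrow> real) \<Rightarrow> (real \<times> real \<Rightarrow> real) \<Rightarrow> real" where
  "Lambda a b c d P h = iterated_integral a b c d (\<lambda>(y, z). P (y, z) * h (y, z))"

(* In the exceptional case q = real n with n \<le> M, and n is recovered as nat (floor q). *)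
definition psi :: "nat \<Rightarrow> real \<Rightarrow> real \<Rightarrow> real \<Rightarrow> real \<times> real \<Rightarrow> real" where
  "psi M k1 k2 q = (\<lambda>(y, z).
     if q \<notin> real ` {0..M}
     then (y + k1) powr q * (z - k2) powr q / (\<Prod>i=0..M. q - real i)\<^sup>2
     else (let n = nat \<lfloor>q\<rfloor> in
       (y + k1) powr q * (z - k2) powr q * (ln ((y + k1) * (z - k2)))\<^sup>2
         / (2 * (fact n * fact (M - n))\<^sup>2)))"

definition exponentially_convex_on :: "real set \<Rightarrow> (real \<Rightarrow> real) \<Rightarrow> bool" where
  "exponentially_convex_on K w \<longleftrightarrow>
     open K \<and> is_interval K \<and> continuous_on K w \<and>
     (\<forall>(m::nat) (\<rho> :: nat \<Rightarrow> real) (y :: nat \<Rightarrow> real).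
        (\<forall>i\<in>{1..m}. \<forall>j\<in>{1..m}. y i + y j \<in> K) \<longrightarrow>
        (\<Sum>i=1..m. \<Sum>j=1..m. \<rho> i * \<rho> j * w (y i + y j)) \<ge> 0)"

definition log_convex_on :: "real set \<Rightarrow> (real \<Rightarrow> real) \<Rightarrow> bool" where
  "log_convex_on K w \<longleftrightarrow>
     (\<forall>y\<in>K. w y > 0) \<and>
     (\<forall>y\<in>K. \<forall>z\<in>K. \<forall>l\<in>{0..1}.
        w (l * y + (1 - l) * z) \<le> w y powr l * w z powr (1 - l))"

definition positive_semidefinite :: "real Matrix.mat \<Rightarrow> bool" where
  "positive_semidefinite A \<longleftrightarrow>
     A \<in> carrier_mat (dim_row A) (dim_row A) \<and> transpose_mat A = A \<and>
     (\<forall>v \<in> carrier_vec (dim_row A). scalar_prod v (mult_mat_vec A v) \<ge> 0)"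

(* The mean of order (s, t) attached to q \<mapsto> F q. It is meaningful only if F t \<noteq> 0 (otherwise the
   value comes from the convention x / 0 = 0), so uses of it are guarded by this condition. *)
definition quotient_mean :: "(real \<Rightarrow> real) \<Rightarrow> real \<Rightarrow> real \<Rightarrow> real" where
  "quotient_mean F s t =
     (if s \<noteq> t then (F s / F t) powr (1 / (s - t)) else exp (deriv F s / F s))"

end

(* Expanding a function of one variable at the right endpoint by Taylor's formula with integral
   remainder, and doing so in both variables of a product f(y) g(z), the vanishing conditions kill
   every term but the one with two remainders; by Fubini
     Lambda(f(y) g(z)) = \<integral>\<integral> K(s, t) f^(M+1)(s) g^(M+1)(t) dt ds,
   where K is the nonnegative function in the last hypothesis. The normalisation of psi is such that
   its mixed derivative of order (M+1, M+1) is ((y + k1) (z - k2)) powr (q - M - 1) for every q, the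
   exceptional ones included. Hence Lambda(psi_q) is a Laplace-type integral \<integral> k exp(q L) with k
   nonnegative and L bounded, which gives continuity, exponential convexity, log-convexity and
   semi-definiteness; the means are exponentials of difference quotients of the convex function
   ln Lambda(psi_q), and these are monotone in both arguments. *)
theory Submission
  imports Defs "Jordan_Normal_Form.Char_Poly"
begin

text \<open>The four hypotheses match the four products of polynomial part or remainder in y with
  polynomial part or remainder in z: three products vanish, the last one yields the kernel, and its
  two signs (-1)^(M+1) cancel. The obstacle is measurability: \<open>P\<close> is only Lebesgue
  integrable, while Fubini is applied to the product of Borel measures. So \<open>P\<close> is
  traded for a Borel density \<open>Q\<close> that is exactly zero off the rectangle, and all
  partial integrals become integrals of \<open>Q\<close> over the plane against truncated powers.
  The denominator of \<open>psi\<close> is squared because each variable contributes q(q-1)...(q-M).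
  For q = n \<le> M that factor is zero. With u = y + k1 and v = z - k2, derivatives of order M+1
  kill u^n and v^n, so only 2 ln u ln v survives from ln(u v)^2, and u^n ln u becomes (-1)^(M-n) n!
  (M-n)! u^(n-M-1); hence the constant 2 (n! (M-n)!)^2. The weight of the Laplace integral does not
  depend on q, so Lambda(psi_q) is either zero for all q or positive for all q; this gives
  logarithms a meaning in the claim on means.\<close>

unbundle no vec_syntax

section \<open>Determinants and slopes\<close>

text \<open>The monic polynomial det(x I + A) has no positive root, since such a root would be a positive
  eigenvalue of -A; so its value at 0 cannot be negative.\<close>
lemma psd_det_nonneg:
  assumes "positive_semidefinite A"
  shows "Determinant.det A \<ge> 0"
proof (rule ccontr)
  assume neg: "\<not> Determinant.det A \<ge> 0"
  define n where "n = dim_row A"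
  have A: "A \<in> carrier_mat n n"
    and psd: "\<And>v. v \<in> carrier_vec n \<Longrightarrow> scalar_prod v (mult_mat_vec A v) \<ge> 0"
    using assms by (auto simp: positive_semidefinite_def n_def)
  have mA: "- A \<in> carrier_mat n n" using A by simp
  define p where "p = char_poly (- A)"
  have lead: "lead_coeff p = 1"
    using degree_monic_char_poly[OF mA] by (auto simp: p_def)
  have "- char_matrix (- A) 0 = A"
    by (rule eq_matI) (use A in \<open>auto simp: char_matrix_def\<close>)
  then have p0: "poly p 0 = Determinant.det A"
    unfolding p_def by (subst char_poly_matrix[OF mA]) simp
  obtain N where N: "\<And>x. x \<ge> N \<Longrightarrow> poly p x \<ge> 1"
    using poly_pinfty_gt_lc[of p] lead by auto
  \<comment> \<open>\<open>max N 1\<close> is positive and lies in the range where \<open>p\<close>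
    is at least 1; at 0 the value of \<open>p\<close> is the determinant, assumed negative.\<close>
  have "\<exists>x. 0 < x \<and> x < max N 1 \<and> poly p x = 0"
    by (rule poly_IVT_pos) (use neg p0 N[of "max N 1"] in auto)
  then obtain x where x: "x > 0" "poly p x = 0" by blast
  then have "eigenvalue (- A) x"
    using eigenvalue_root_char_poly[OF mA] by (simp add: p_def)
  then obtain v where v: "v \<in> carrier_vec n" "v \<noteq> 0\<^sub>v n" "mult_mat_vec (- A) v = x \<cdot>\<^sub>v v"
    using A by (auto simp: eigenvalue_def eigenvector_def)
  have "x * scalar_prod v v = scalar_prod v (mult_mat_vec (- A) v)"
    using v by simp
  also have "\<dots> = - scalar_prod v (mult_mat_vec A v)"
    using v(1) A by (simp add: uminus_mult_mat_vec)
  also have "\<dots> \<le> 0" using psd[OF v(1)] by simp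
  finally have "x * scalar_prod v v \<le> 0" .
  moreover have "scalar_prod v v > 0"
  proof -
    obtain i where i: "i < n" "v $ i \<noteq> 0" using v(1,2) by (metis carrier_vecD eq_vecI index_zero_vec)
    have "scalar_prod v v = (\<Sum>i = 0..<n. v $ i * v $ i)"
      using v(1) by (simp add: scalar_prod_def)
    also have "\<dots> > 0"
      by (rule sum_pos2[of _ i]) (use i in \<open>auto simp: zero_less_mult_iff\<close>)
    finally show ?thesis .
  qed
  ultimately show False using x(1) by (simp add: mult_le_0_iff)
qed

text \<open>Filling in the derivative on the diagonal keeps the difference quotient of a convex
  function monotone in its first argument: chord slopes settle distinct points, the tangent
  inequality settles the diagonal. Since the quotient is symmetric, monotonicity in the second
  argument follows.\<close>

lemma convex_slope_mono:
  fixes g g' :: "real \<Rightarrow> real"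
  assumes convex: "convex_on UNIV g"
    and deriv: "\<And>x. (g has_field_derivative g' x) (at x)"
    and le: "s \<le> u" "t \<le> v"
  defines "sl \<equiv> (\<lambda>s t. if s = t then g' s else (g s - g t) / (s - t))"
  shows "sl s t \<le> sl u v"
proof -
  have tangent: "g x - g y \<ge> g' y * (x - y)" for x y
    by (rule convex_on_imp_above_tangent[OF convex]) (auto simp: deriv has_field_derivative_at_within)
  have sym: "sl x y = sl y x" for x y
    using minus_divide_divide[of "g x - g y" "x - y"] by (simp add: sl_def)
  have mono: "sl x y \<le> sl z y" if "x < z" for x y z
  proof -
    consider "y = x" | "y = z" | "y < x" | "z < y" | "x < y" "y < z" by linarith
    then show ?thesis
    proof cases
      case 1
      then show ?thesis using that tangent[of x z] by (simp add: sl_def field_simps)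
    next
      case 2
      then show ?thesis using that tangent[of z x] by (simp add: sl_def field_simps)
    next
      case 3
      then show ?thesis using that convex_on_slope_le(1)[OF convex, of y z x]
        by (simp add: sl_def sym[unfolded sl_def])
    next
      case 4
      then show ?thesis using that convex_on_slope_le(2)[OF convex, of x y z] 
        by (simp add: sl_def)
    next
      \<comment> \<open>With \<open>y\<close> strictly between, the slopes on its two sides are
        compared through the chord from \<open>x\<close> to \<open>z\<close>.\<close>
      case 5
      then show ?thesis using order_trans[OF convex_on_slope_le[OF convex, of x z y]]
        by (simp add: sl_def) (smt (verit) minus_divide_divide minus_diff_eq)
    qed
  qed
  have "sl s t \<le> sl u t" using mono[of s u t] le by (cases "s = u") auto
  also have "\<dots> = sl t u" by (rule sym)
  also have "\<dots> \<le> sl v u" using mono[of t v u] le by (cases "t = v") auto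
  finally show ?thesis by (simp add: sym[of v u])
qed

section \<open>Laplace-type integrals\<close>

text \<open>\<open>F\<close> is the two-sided Laplace transform of a finite measure on [-B, B],
  namely the image under \<open>L\<close> of the measure with density \<open>k\<close>.
  Nonnegativity and the bound are required at every point; cutting \<open>k\<close> and
  \<open>L\<close> off outside the rectangle will ensure this.\<close>

locale exponential_mixture =
  fixes N :: "'a measure" and k L :: "'a \<Rightarrow> real" and B :: real and F :: "real \<Rightarrow> real"
  assumes integrable_weight: "integrable N k"
    and weight_nonneg: "\<And>x. k x \<ge> 0"
    and exponent_measurable [measurable]: "L \<in> borel_measurable N"
    and exponent_bound: "\<And>x. \<bar>L x\<bar> \<le> B"
    and F_eq: "\<And>q. F q = (\<integral>x. k x * exp (q * L x) \<partial>N)"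
begin

lemma weight_measurable [measurable]: "k \<in> borel_measurable N"
  using integrable_weight by auto

lemma exp_bound: "\<bar>k x * exp (q * L x)\<bar> \<le> k x * exp (\<bar>q\<bar> * B)"
proof -
  have "q * L x \<le> \<bar>q * L x\<bar>" by simp
  also have "\<dots> \<le> \<bar>q\<bar> * B"
    unfolding abs_mult by (rule mult_left_mono[OF exponent_bound]) simp
  finally show ?thesis
    using weight_nonneg[of x] by (auto simp: abs_mult intro!: mult_left_mono)
qed

lemma integrable_integrand: "integrable N (\<lambda>x. k x * exp (q * L x))"
proof (rule Bochner_Integration.integrable_bound)
  show "integrable N (\<lambda>x. k x * exp (\<bar>q\<bar> * B))" using integrable_weight by simp
  show "AE x in N. norm (k x * exp (q * L x)) \<le> norm (k x * exp (\<bar>q\<bar> * B))"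
    using exp_bound weight_nonneg by (auto simp: abs_mult)
qed measurable

lemma F_nonneg: "F q \<ge> 0"
  unfolding F_eq by (rule integral_nonneg_AE) (auto simp: weight_nonneg)

text \<open>Sequences suffice here, and a convergent sequence of parameters is bounded by some
  \<open>C\<close>, so \<open>k x * exp (C * B)\<close> dominates all integrands at once.\<close>

lemma continuous_F: "continuous_on UNIV F"
proof (rule continuous_at_imp_continuous_on, clarify, rule continuous_at_sequentiallyI)
  fix q and u :: "nat \<Rightarrow> real"
  assume u: "u \<longlonglongrightarrow> q"
  then have "Bseq u" using convergent_def convergent_imp_Bseq by blast
  then obtain C where C: "\<And>n. \<bar>u n\<bar> \<le> C" by (auto simp: Bseq_def)
  show "(\<lambda>n. F (u n)) \<longlonglongrightarrow> F q"
    unfolding F_eq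
  proof (rule integral_dominated_convergence[where w = "\<lambda>x. k x * exp (C * B)"])
    show "AE x in N. (\<lambda>i. k x * exp (u i * L x)) \<longlonglongrightarrow> k x * exp (q * L x)"
      by (intro AE_I2 tendsto_intros u)
    show "AE x in N. norm (k x * exp (u i * L x)) \<le> k x * exp (C * B)" for i
    proof (rule AE_I2)
      fix x
      have "B \<ge> 0" using exponent_bound[of x] by linarith
      then have "\<bar>u i\<bar> * B \<le> C * B" using C[of i] by (rule mult_right_mono[rotated])
      then have "k x * exp (\<bar>u i\<bar> * B) \<le> k x * exp (C * B)"
        using weight_nonneg[of x] by (intro mult_left_mono) auto
      then show "norm (k x * exp (u i * L x)) \<le> k x * exp (C * B)"
        using exp_bound[of x "u i"] by simp
    qed
  qed (use integrable_weight in simp_all)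
qed

text \<open>As exp turns sums into products, the double sum under the integral is \<open>k\<close>
  times the square of a single sum.\<close>

lemma quadratic_form_nonneg:
  fixes \<rho> y :: "'i \<Rightarrow> real"
  shows "(\<Sum>i\<in>S. \<Sum>j\<in>S. \<rho> i * \<rho> j * F (y i + y j)) \<ge> 0"
proof -
  have "(\<Sum>i\<in>S. \<Sum>j\<in>S. \<rho> i * \<rho> j * F (y i + y j)) =
      (\<integral>x. (\<Sum>i\<in>S. \<Sum>j\<in>S. \<rho> i * \<rho> j * (k x * exp ((y i + y j) * L x))) \<partial>N)"
    unfolding F_eq using integrable_integrand by (simp add: Bochner_Integration.integral_sum)
  also have "\<dots> = (\<integral>x. k x * (\<Sum>i\<in>S. \<rho> i * exp (y i * L x))\<^sup>2 \<partial>N)"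
    by (rule Bochner_Integration.integral_cong)
      (simp_all add: power2_eq_square sum_product sum_distrib_left distrib_left distrib_right exp_add mult_ac)
  also have "\<dots> \<ge> 0" by (rule integral_nonneg_AE) (auto simp: weight_nonneg)
  finally show ?thesis .
qed

lemma exponentially_convex: "exponentially_convex_on UNIV F"
  unfolding exponentially_convex_on_def using continuous_F quadratic_form_nonneg by (auto simp del: One_nat_def)

lemma positive_semidefinite_F:
  "positive_semidefinite (Matrix.mat m m (\<lambda>(i, j). F ((q i + q j) / 2)))" (is "positive_semidefinite ?A")
  unfolding positive_semidefinite_def
proof (intro conjI ballI)
  show "transpose_mat ?A = ?A" by (rule eq_matI) (auto simp: add.commute)
next
  fix v :: "real Matrix.vec" assume "v \<in> carrier_vec (dim_row ?A)"
  then have "scalar_prod v (mult_mat_vec ?A v) =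
      (\<Sum>i = 0..<m. \<Sum>j = 0..<m. v $ i * v $ j * F (q i / 2 + q j / 2))"
    by (simp add: scalar_prod_def sum_distrib_left add_divide_distrib mult_ac)
  then show "scalar_prod v (mult_mat_vec ?A v) \<ge> 0"
    using quadratic_form_nonneg[of "\<lambda>i. v $ i" "\<lambda>i. q i / 2" "{0..<m}"] by simp
qed simp

text \<open>The exponential factor never vanishes, so a zero of \<open>F\<close> forces
  \<open>k\<close> to vanish almost everywhere, and then \<open>F\<close> is zero
  throughout.\<close>

lemma F_pos:
  assumes "F t \<noteq> 0"
  shows "F q > 0"
proof (rule ccontr)
  assume "\<not> F q > 0"
  then have "F q = 0" using F_nonneg[of q] by simp
  then have "AE x in N. k x * exp (q * L x) = 0"
    unfolding F_eq
    using integral_nonneg_eq_0_iff_AE[OF integrable_integrand[of q]] by (simp add: weight_nonneg)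
  then have "F t = (\<integral>x. 0 \<partial>N)"
    unfolding F_eq by (intro integral_cong_AE) auto
  then show False using assms by simp
qed

text \<open>Integrating the weighted inequality between the arithmetic and the geometric mean for the two
  integrands, each normalised by its integral, gives a form of Hoelder's inequality.\<close>
lemma F_log_convex:
  assumes pos: "\<And>q. F q > 0"
  shows "log_convex_on UNIV F"
  unfolding log_convex_on_def
proof (intro conjI ballI)
  fix y z l :: real assume l: "l \<in> {0..1}"
  let ?c = "F y powr l * F z powr (1 - l)"
  have c: "?c > 0" using pos[of y] pos[of z] by simp
  have "F (l * y + (1 - l) * z) / ?c =
      (\<integral>x. k x * exp ((l * y + (1 - l) * z) * L x) / ?c \<partial>N)"
    unfolding F_eq[of "l * y + (1 - l) * z"] by simp
  also have "\<dots> \<le> (\<integral>x. l * (k x * exp (y * L x)) / F y + (1 - l) * (k x * exp (z * L x)) / F z \<partial>N)"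
  proof (rule integral_mono)
    fix x
    have "(exp (y * L x) / F y) powr l * (exp (z * L x) / F z) powr (1 - l)
        \<le> l * (exp (y * L x) / F y) + (1 - l) * (exp (z * L x) / F z)"
      by (rule Youngs_inequality_0) (use l pos in auto)
    also have "(exp (y * L x) / F y) powr l * (exp (z * L x) / F z) powr (1 - l)
        = exp ((l * y + (1 - l) * z) * L x) / ?c"
      using pos[of y] pos[of z]
      by (simp add: powr_divide exp_powr_real exp_add[symmetric] algebra_simps)
    finally show "k x * exp ((l * y + (1 - l) * z) * L x) / ?c
        \<le> l * (k x * exp (y * L x)) / F y + (1 - l) * (k x * exp (z * L x)) / F z"
      using mult_left_mono[OF _ weight_nonneg[of x]] by (fastforce simp: algebra_simps)
  qed (use integrable_integrand in auto)
  also have "\<dots> = l * F y / F y + (1 - l) * F z / F z"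
    using integrable_integrand by (simp add: F_eq[symmetric])
  also have "\<dots> = 1" using pos[of y] pos[of z] by simp
  finally show "F (l * y + (1 - l) * z) \<le> ?c" using c by (simp add: divide_le_eq)
qed (use pos in auto)

lemma F_three_points:
  assumes pos: "\<And>q. F q > 0" and "r < s" "s < t"
  shows "F s powr (t - r) \<le> F r powr (t - s) * F t powr (s - r)"
proof -
  \<comment> \<open>This is the weight for which \<open>s\<close> is the convex combination
    \<open>l * r + (1 - l) * t\<close>; raising to the power \<open>t - r\<close> clears the
    denominator.\<close>
  define l where "l = (t - s) / (t - r)"
  have l: "l \<in> {0..1}" "l * (t - r) = t - s" "(1 - l) * (t - r) = s - r"
    using assms(2,3) by (auto simp: l_def field_simps)
  have "l * r + (1 - l) * t = s" using l(2) by (simp add: algebra_simps)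
  then have "F s \<le> F r powr l * F t powr (1 - l)"
    using F_log_convex[OF pos] l(1) unfolding log_convex_on_def by (metis UNIV_I)
  then have "F s powr (t - r) \<le> (F r powr l * F t powr (1 - l)) powr (t - r)"
    using assms(2,3) F_nonneg[of s] by (intro powr_mono2) auto
  also have "\<dots> = F r powr (t - s) * F t powr (s - r)"
    by (simp add: powr_mult powr_powr l)
  finally show ?thesis .
qed

lemma convex_ln_F:
  assumes pos: "\<And>q. F q > 0"
  shows "convex_on UNIV (\<lambda>q. ln (F q))"
  unfolding convex_on_alt
proof (intro conjI ballI allI impI)
  fix x y \<mu> :: real assume \<mu>: "\<mu> \<ge> 0 \<and> \<mu> \<le> 1"
  then have "F (\<mu> * x + (1 - \<mu>) * y) \<le> F x powr \<mu> * F y powr (1 - \<mu>)"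
    using F_log_convex[OF pos] unfolding log_convex_on_def by simp
  then have "ln (F (\<mu> * x + (1 - \<mu>) * y)) \<le> ln (F x powr \<mu> * F y powr (1 - \<mu>))"
    using pos[of "\<mu> * x + (1 - \<mu>) * y"] by (rule ln_mono)
  also have "\<dots> = \<mu> * ln (F x) + (1 - \<mu>) * ln (F y)"
    using pos[of x] pos[of y] by (simp add: ln_mult ln_powr)
  finally show "ln (F (\<mu> *\<^sub>R x + (1 - \<mu>) *\<^sub>R y)) \<le> \<mu> * ln (F x) + (1 - \<mu>) * ln (F y)" by simp
qed simp

text \<open>For positive \<open>F\<close> the mean is the exponential of a slope of
  \<open>ln F\<close>, or of its derivative on the diagonal, and \<open>ln F\<close> is
  convex.\<close>

lemma quotient_mean_mono:
  assumes diff: "F differentiable_on UNIV" and "F t \<noteq> 0" and le: "s \<le> u" "t \<le> v"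
  shows "quotient_mean F s t \<le> quotient_mean F u v"
proof -
  have pos: "F q > 0" for q using F_pos[OF assms(2)] .
  have "F differentiable (at x)" for x
    using diff by (simp add: differentiable_on_def)
  then have dF: "(F has_field_derivative deriv F x) (at x)" for x
    by (simp add: DERIV_deriv_iff_real_differentiable)
  have dln: "((\<lambda>q. ln (F q)) has_field_derivative deriv F x / F x) (at x)" for x
    using pos[of x] by (auto intro!: derivative_eq_intros dF)
  have eq: "quotient_mean F x y =
      exp (if x = y then deriv F x / F x else (ln (F x) - ln (F y)) / (x - y))" for x y
    using pos[of x] pos[of y] by (simp add: quotient_mean_def powr_def ln_div)
  show ?thesis
    unfolding eq using convex_slope_mono[OF convex_ln_F[OF pos] dln le] by simp
qed

end

section \<open>Taylor expansion and Fubini\<close>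

text \<open>In a complete measure space, agreement almost everywhere with a Borel function makes
  \<open>f\<close> measurable. This is meant for the sections of \<open>P\<close>, whose
  measurability is not known beforehand.\<close>

lemma integral_lebesgue_eq_lborel_AE:
  fixes f g :: "'a::euclidean_space \<Rightarrow> real"
  assumes eq: "AE x in lborel. f x = g x" and g: "g \<in> borel_measurable borel"
  shows "integral\<^sup>L lebesgue f = integral\<^sup>L lborel g"
proof -
  have g': "g \<in> borel_measurable lebesgue" using g by (auto intro: measurable_completion)
  have eq': "AE x in lebesgue. g x = f x" using AE_completion[OF eq] by auto
  have "integral\<^sup>L lebesgue g = integral\<^sup>L lebesgue f"
    by (rule integral_cong_AE[OF g' borel_measurable_AE[OF g' eq'] eq'])
  then show ?thesis using g by (simp add: integral_completion)
qed

text \<open>A Lebesgue integrable function agrees almost everywhere with a Borel one, to which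
  Fubini applies. A single \<open>Q\<close> serves all \<open>s\<close>, \<open>t\<close> and
  \<open>h\<close>; the bounds on \<open>s\<close> and \<open>t\<close> keep the domain of
  integration inside the rectangle.\<close>

lemma iterated_integral_borel_density:
  fixes P :: "real \<times> real \<Rightarrow> real"
  assumes P: "set_integrable lebesgue ({a..b} \<times> {c..d}) P"
  obtains Q where "integrable lborel Q" "\<And>w. w \<notin> {a..b} \<times> {c..d} \<Longrightarrow> Q w = 0"
    "\<And>s t h. s \<le> b \<Longrightarrow> t \<le> d \<Longrightarrow> continuous_on ({a..b} \<times> {c..d}) h \<Longrightarrow>
      iterated_integral a s c t (\<lambda>w. P w * h w) =
        (\<integral>w. Q w * (indicator ({..s} \<times> {..t}) w * h w) \<partial>lborel)"
proof -
  define R where "R = {a..b} \<times> {c..d}"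
  have compR: "compact R" unfolding R_def by (intro compact_Times compact_Icc)
  then have R[measurable]: "R \<in> sets borel" by (simp add: borel_compact)
  define f where "f = (\<lambda>w. indicator R w * P w)"
  have f: "integrable lebesgue f"
    using P by (simp add: set_integrable_def f_def R_def)
  then obtain Q0 where Q0[measurable]: "Q0 \<in> borel_measurable borel" and Q0f: "AE w in lborel. f w = Q0 w"
    using completion_ex_borel_measurable_real[of f lborel] by auto
  define Q where "Q = (\<lambda>w. indicator R w * Q0 w)"
  have Qm[measurable]: "Q \<in> borel_measurable borel" unfolding Q_def by measurable
  have fQ: "AE w in lborel. f w = Q w"
    using Q0f by eventually_elim (auto simp: Q_def f_def indicator_def)
  have "integrable lebesgue Q"
    by (rule integrable_cong_AE_imp[OF f])
      (use AE_completion[OF fQ] in \<open>auto intro: measurable_completion\<close>)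
  then have Q: "integrable lborel Q" by (simp add: integrable_completion)
  have supp: "Q w = 0" if "w \<notin> R" for w using that by (simp add: Q_def)
  have "iterated_integral a s c t (\<lambda>w. P w * h w) =
        (\<integral>w. Q w * (indicator ({..s} \<times> {..t}) w * h w) \<partial>lborel)"
    if st: "s \<le> b" "t \<le> d" and h: "continuous_on R h" for s t h
  proof -
    \<comment> \<open>\<open>h\<close> is controlled only on \<open>R\<close>; its cut-off
      \<open>H\<close> is Borel measurable on the whole plane.\<close>
    define H where "H = (\<lambda>w. indicator R w * h w)"
    define I where "I = (\<lambda>w. Q w * (indicator ({..s} \<times> {..t}) w * H w))"
    have Hm[measurable]: "H \<in> borel_measurable borel"
      using borel_measurable_continuous_on_indicator[OF R h] by (simp add: H_def)
    have [measurable]: "{..s} \<times> {..t} \<in> sets borel"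
      by (intro borel_closed closed_Times closed_atMost)
    have Im[measurable]: "I \<in> borel_measurable borel" unfolding I_def by measurable
    obtain C where C: "\<And>w. w \<in> R \<Longrightarrow> \<bar>h w\<bar> \<le> C"
      using compact_imp_bounded[OF compact_continuous_image[OF h compR]]
      by (auto simp: bounded_iff)
    have I: "integrable lborel I"
    proof (rule Bochner_Integration.integrable_bound)
      show "integrable lborel (\<lambda>w. \<bar>C\<bar> * Q w)" using Q by simp
      have "\<bar>I w\<bar> \<le> \<bar>\<bar>C\<bar> * Q w\<bar>" for w
      proof (cases "w \<in> R")
        case True
        then have "\<bar>indicator ({..s} \<times> {..t}) w * H w\<bar> \<le> \<bar>C\<bar>"
          using C[of w] by (auto simp: H_def indicator_def)
        then have "\<bar>Q w\<bar> * \<bar>indicator ({..s} \<times> {..t}) w * H w\<bar> \<le> \<bar>Q w\<bar> * \<bar>C\<bar>"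
          by (rule mult_left_mono) simp
        then show ?thesis by (simp add: I_def abs_mult mult_ac)
      qed (simp add: I_def H_def)
      then show "AE w in lborel. norm (I w) \<le> norm (\<bar>C\<bar> * Q w)" by simp
    qed simp
    have I': "integrable (lborel \<Otimes>\<^sub>M lborel) I" using I by (simp add: lborel_prod)
    have Im': "I \<in> borel_measurable (lborel \<Otimes>\<^sub>M lborel)" using I' by auto
    have "AE w in lborel \<Otimes>\<^sub>M lborel. f w = Q w" using fQ by (subst lborel_prod)
    \<comment> \<open>Almost every section of a null set in the plane is null; the remaining values
      of \<open>y\<close> form a null set and do not affect the outer integral.\<close>
    then have "AE y in lborel. AE z in lborel. f (y, z) = Q (y, z)"
      by (rule lborel_pair.AE_pair)
    then have "AE y in lborel. indicator {a..s} y *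
        (set_lebesgue_integral lebesgue {c..t} (\<lambda>z. P (y, z) * h (y, z))) = (\<integral>z. I (y, z) \<partial>lborel)"
    proof eventually_elim
      case (elim y)
      show ?case
      proof (cases "y \<in> {a..s}")
        case True
        have "AE z in lborel. indicator {c..t} z * (P (y, z) * h (y, z)) = I (y, z)"
          using elim
        proof eventually_elim
          case (elim z)
          then show ?case
            using True st by (auto simp: I_def H_def f_def R_def indicator_def split: if_splits)
        qed
        moreover have "(\<lambda>z. I (y, z)) \<in> borel_measurable borel"
          using measurable_compose[OF _ Im', of "\<lambda>z. (y, z)" lborel] by simp
        ultimately have "integral\<^sup>L lebesgue (\<lambda>z. indicator {c..t} z * (P (y, z) * h (y, z)))
            = (\<integral>z. I (y, z) \<partial>lborel)"
          by (rule integral_lebesgue_eq_lborel_AE)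
        then show ?thesis using True by (simp add: set_lebesgue_integral_def)
      next
        case False
        then have "I (y, z) = 0" for z by (auto simp: I_def H_def R_def indicator_def)
        then show ?thesis using False by simp
      qed
    qed
    moreover have "(\<lambda>y. \<integral>z. I (y, z) \<partial>lborel) \<in> borel_measurable borel"
      using lborel_pair.integrable_fst'[OF I'] by auto
    ultimately have "integral\<^sup>L lebesgue (\<lambda>y. indicator {a..s} y *
        (set_lebesgue_integral lebesgue {c..t} (\<lambda>z. P (y, z) * h (y, z))))
        = (\<integral>y. \<integral>z. I (y, z) \<partial>lborel \<partial>lborel)"
      by (rule integral_lebesgue_eq_lborel_AE)
    also have "\<dots> = integral\<^sup>L lborel I"
      using lborel_pair.integral_fst'[OF I'] by (simp add: lborel_prod)
    \<comment> \<open>Replacing \<open>H\<close> by \<open>h\<close> again is harmless, since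
      \<open>Q\<close> is exactly zero outside \<open>R\<close>.\<close>
    also have "I = (\<lambda>w. Q w * (indicator ({..s} \<times> {..t}) w * h w))"
      by (auto simp: fun_eq_iff I_def H_def Q_def indicator_def)
    finally show ?thesis by (simp add: iterated_integral_def set_lebesgue_integral_def)
  qed
  then show thesis using that[of Q] Q supp unfolding R_def by blast
qed

text \<open>The majorant is a product of integrable functions of one variable each, so
  \<open>Q w * G s w\<close> is jointly integrable without being a product itself.\<close>

lemma weighted_Fubini_lborel:
  fixes Q :: "'a::euclidean_space \<Rightarrow> real" and G :: "'b::euclidean_space \<Rightarrow> 'a \<Rightarrow> real"
  assumes Q: "integrable lborel Q" and S: "integrable lborel (indicator S :: 'b \<Rightarrow> real)"
    and G: "(\<lambda>(s, w). G s w) \<in> borel_measurable (lborel \<Otimes>\<^sub>M lborel)"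
    and bound: "\<And>s w. \<bar>Q w * G s w\<bar> \<le> C * indicator S s * \<bar>Q w\<bar>"
  shows "integrable lborel (\<lambda>w. Q w * (\<integral>s. G s w \<partial>lborel))"
    and "integrable lborel (\<lambda>s. \<integral>w. Q w * G s w \<partial>lborel)"
    and "(\<integral>w. Q w * (\<integral>s. G s w \<partial>lborel) \<partial>lborel) = (\<integral>s. \<integral>w. Q w * G s w \<partial>lborel \<partial>lborel)"
proof -
  have Qm[measurable]: "Q \<in> borel_measurable borel" using Q by auto
  have Sm[measurable]: "(indicator S :: 'b \<Rightarrow> real) \<in> borel_measurable borel" using S by auto
  have "integrable (lborel \<Otimes>\<^sub>M lborel) (\<lambda>(s, w). C * indicator S s * \<bar>Q w\<bar>)"
    by (rule lborel_pair.Fubini_integrable) (use Q S in \<open>auto simp: abs_mult\<close>)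
  moreover have "(\<lambda>(s, w). Q w * G s w) \<in> borel_measurable (lborel \<Otimes>\<^sub>M lborel)"
    using G by measurable
  ultimately have int: "integrable (lborel \<Otimes>\<^sub>M lborel) (\<lambda>(s, w). Q w * G s w)"
    by (rule Bochner_Integration.integrable_bound) (use order_trans[OF bound abs_ge_self] in auto)
  show "integrable lborel (\<lambda>w. Q w * (\<integral>s. G s w \<partial>lborel))"
    using lborel_pair.integrable_snd[OF int] by simp
  show "integrable lborel (\<lambda>s. \<integral>w. Q w * G s w \<partial>lborel)"
    using lborel_pair.integrable_fst[OF int] by simp
  show "(\<integral>w. Q w * (\<integral>s. G s w \<partial>lborel) \<partial>lborel) = (\<integral>s. \<integral>w. Q w * G s w \<partial>lborel \<partial>lborel)"
    using lborel_pair.Fubini_integral[OF int] by simp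
qed

section \<open>Truncated powers and Taylor's formula\<close>

text \<open>This is the Peano kernel of Taylor's formula at the right endpoint. For M = 0 its value
  at y = s is 1, so it equals the indicator of \<open>{..s}\<close> times the power at every point,
  in accordance with the convention 0^0 = 1.\<close>

definition trunc_power :: "nat \<Rightarrow> real \<Rightarrow> real \<Rightarrow> real" where
  "trunc_power M s y = (if y \<le> s then (s - y) ^ M / fact M else 0)"

text \<open>With \<open>y\<close> fixed, the Taylor sum is differentiated in its centre
  \<open>s\<close>: the derivative telescopes to a single term, and integrating it from
  \<open>y\<close> to \<open>b\<close> gives the remainder. The alternating signs come from
  expanding to the left of the centre.\<close>

lemma Taylor_right_endpoint:
  fixes D :: "nat \<Rightarrow> real \<Rightarrow> real"
  assumes y: "y \<in> {a..b}"
    and D: "\<And>i s. i \<le> M \<Longrightarrow> s \<in> {a..b} \<Longrightarrow> (D i has_field_derivative D (Suc i) s) (at s within {a..b})"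
    and cont: "continuous_on {a..b} (D (Suc M))"
  shows "D 0 y = (\<Sum>i\<le>M. (-1) ^ i * D i b / fact i * (b - y) ^ i)
    + (-1) ^ Suc M * (\<integral>s. (indicator {a..b} s * D (Suc M) s) * trunc_power M s y \<partial>lborel)"
proof -
  have sub: "{y..b} \<subseteq> {a..b}" using y by auto
  have deriv: "((\<lambda>s. \<Sum>i\<le>m. (-1) ^ i * D i s / fact i * (s - y) ^ i) has_field_derivative
      (-1) ^ m * D (Suc m) s * (s - y) ^ m / fact m) (at s within {y..b})"
    if "m \<le> M" "s \<in> {y..b}" for m s
    using that(1)
  proof (induction m)
    case 0
    then show ?case using DERIV_subset[OF D sub, of 0 s] that(2) sub by auto
  next
    case (Suc m)
    have D': "(D (Suc m) has_field_derivative D (Suc (Suc m)) s) (at s within {y..b})"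
      using DERIV_subset[OF D sub, of "Suc m" s] Suc.prems that(2) sub by auto
    have pow: "((\<lambda>s. (s - y) ^ Suc m) has_field_derivative real (Suc m) * (s - y) ^ m) (at s within {y..b})"
      by (auto intro!: derivative_eq_intros simp del: power_Suc)
    have "((\<lambda>s. (-1) ^ Suc m * D (Suc m) s / fact (Suc m) * (s - y) ^ Suc m) has_field_derivative
        (-1) ^ Suc m * D (Suc (Suc m)) s / fact (Suc m) * (s - y) ^ Suc m
        + (-1) ^ Suc m * D (Suc m) s / fact (Suc m) * (real (Suc m) * (s - y) ^ m)) (at s within {y..b})"
      by (rule DERIV_cong[OF DERIV_mult[OF DERIV_cdivide[OF DERIV_cmult[OF D']] pow]])
        (simp only: mult_ac)
    \<comment> \<open>Differentiating the power in the new summand cancels what the shorter sum left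
      over; this is the telescoping.\<close>
    moreover have "(-1) ^ Suc m * D (Suc m) s / fact (Suc m) * (real (Suc m) * (s - y) ^ m)
        = - ((-1) ^ m * D (Suc m) s * (s - y) ^ m / fact m)"
      by (simp add: divide_simps del: of_nat_Suc)
    ultimately have "((\<lambda>s. (-1) ^ Suc m * D (Suc m) s / fact (Suc m) * (s - y) ^ Suc m) has_field_derivative
        (-1) ^ Suc m * D (Suc (Suc m)) s * (s - y) ^ Suc m / fact (Suc m)
        - (-1) ^ m * D (Suc m) s * (s - y) ^ m / fact m) (at s within {y..b})"
      by (simp only: add_uminus_conv_diff times_divide_eq_left)
    from DERIV_add[OF Suc.IH this] Suc.prems show ?case
      by (simp only: sum.atMost_Suc Suc_leD diff_add_cancel add.commute[of _ "_ - _"])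
  qed
  have "(\<integral>s. indicator {y..b} s *\<^sub>R ((-1) ^ M * D (Suc M) s * (s - y) ^ M / fact M) \<partial>lborel)
      = (\<Sum>i\<le>M. (-1) ^ i * D i b / fact i * (b - y) ^ i)
        - (\<Sum>i\<le>M. (-1) ^ i * D i y / fact i * (y - y) ^ i)"
  proof (rule integral_FTC_Icc)
    show "y \<le> b" using y by simp
    show "((\<lambda>s. \<Sum>i\<le>M. (-1) ^ i * D i s / fact i * (s - y) ^ i) has_vector_derivative
      (-1) ^ M * D (Suc M) s * (s - y) ^ M / fact M) (at s within {y..b})" if "y \<le> s" "s \<le> b" for s
      using deriv[of M s] that by (simp add: has_real_derivative_iff_has_vector_derivative)
    show "continuous_on {y..b} (\<lambda>s. (-1) ^ M * D (Suc M) s * (s - y) ^ M / fact M)"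
      by (intro continuous_intros continuous_on_subset[OF cont sub]) auto
  qed
  \<comment> \<open>At the centre s = y only i = 0 contributes, through 0^0 = 1.\<close>
  moreover have "(\<Sum>i\<le>M. (-1) ^ i * D i y / fact i * (y - y) ^ i) = D 0 y"
    by (subst sum.atMost_shift) simp
  moreover have "(\<integral>s. indicator {y..b} s *\<^sub>R ((-1) ^ M * D (Suc M) s * (s - y) ^ M / fact M) \<partial>lborel)
      = (\<integral>s. (-1) ^ M * ((indicator {a..b} s * D (Suc M) s) * trunc_power M s y) \<partial>lborel)"
    using y by (intro Bochner_Integration.integral_cong) (auto simp: trunc_power_def indicator_def)
  ultimately show ?thesis by simp
qed

lemma integrable_indicator_compact:
  fixes S :: "'a::euclidean_space set"
  assumes "compact S"
  shows "integrable lborel (indicator S :: 'a \<Rightarrow> real)"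
  using emeasure_compact_finite[OF assms] assms
  by (auto intro!: integrable_real_indicator borel_compact)

lemma integral_lborel_mult_fst_snd:
  fixes f :: "'a::euclidean_space \<Rightarrow> real" and g :: "'b::euclidean_space \<Rightarrow> real"
  assumes f: "integrable lborel f" and g: "integrable lborel g"
  shows "(\<integral>v. f (fst v) * g (snd v) \<partial>lborel) = (\<integral>x. f x \<partial>lborel) * (\<integral>y. g y \<partial>lborel)"
proof -
  have [measurable]: "f \<in> borel_measurable borel" "g \<in> borel_measurable borel"
    using f g by auto
  have "integrable (lborel \<Otimes>\<^sub>M lborel) (\<lambda>v. f (fst v) * g (snd v))"
    by (rule lborel_pair.Fubini_integrable) (use f g in \<open>auto simp: abs_mult\<close>)
  from lborel_pair.integral_fst'[OF this] show ?thesis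
    by (simp add: lborel_prod)
qed

lemma borel_measurable_fst_snd [measurable]:
  fixes f :: "'c \<Rightarrow> 'a::second_countable_topology \<times> 'b::second_countable_topology"
  assumes [measurable]: "f \<in> borel_measurable N"
  shows "(\<lambda>x. fst (f x)) \<in> borel_measurable N" "(\<lambda>x. snd (f x)) \<in> borel_measurable N"
  using assms unfolding borel_prod[symmetric] by measurable

lemma trunc_power_measurable [measurable]:
  "(\<lambda>x. trunc_power M (f x) (g x)) \<in> borel_measurable N"
  if [measurable]: "f \<in> borel_measurable N" "g \<in> borel_measurable N"
  unfolding trunc_power_def by measurable

lemma trunc_power_bound:
  assumes "a \<le> y" "s \<le> b"
  shows "\<bar>trunc_power M s y\<bar> \<le> \<bar>b - a\<bar> ^ M / fact M"
  using assms by (auto simp: trunc_power_def intro!: divide_right_mono power_mono)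

lemma integrable_bounded_trunc_power:
  assumes [measurable]: "\<phi> \<in> borel_measurable borel"
    and \<phi>: "\<And>s. \<bar>\<phi> s\<bar> \<le> C * indicator {a..b} s" and y: "a \<le> y"
  shows "integrable lborel (\<lambda>s. \<phi> s * trunc_power M s y)"
proof (rule Bochner_Integration.integrable_bound)
  show "integrable lborel (\<lambda>s. C * (\<bar>b - a\<bar> ^ M / fact M) * indicator {a..b} s :: real)"
    by (intro integrable_mult_right integrable_indicator_compact compact_Icc)
  have "\<bar>\<phi> s * trunc_power M s y\<bar> \<le> \<bar>C * (\<bar>b - a\<bar> ^ M / fact M) * indicator {a..b} s\<bar>" for s
  proof (cases "s \<in> {a..b}")
    case True
    then have "\<bar>\<phi> s\<bar> * \<bar>trunc_power M s y\<bar> \<le> \<bar>C\<bar> * (\<bar>b - a\<bar> ^ M / fact M)"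
      using \<phi>[of s] y by (intro mult_mono trunc_power_bound) auto
    then show ?thesis using True by (simp add: abs_mult)
  qed (use \<phi>[of s] in simp)
  then show "AE s in lborel. norm (\<phi> s * trunc_power M s y)
      \<le> norm (C * (\<bar>b - a\<bar> ^ M / fact M) * indicator {a..b} s)" by simp
qed simp

lemma indicator_times_continuous:
  fixes f :: "real \<Rightarrow> real"
  assumes f: "continuous_on {a..b} f"
  obtains C where "(\<lambda>s. indicator {a..b} s * f s) \<in> borel_measurable borel"
    "\<And>s. \<bar>indicator {a..b} s * f s\<bar> \<le> C * indicator {a..b} s"
proof -
  obtain C where "\<forall>x\<in>f ` {a..b}. norm x \<le> C"
    using compact_imp_bounded[OF compact_continuous_image[OF f compact_Icc]]
    unfolding bounded_iff by blast
  moreover have "(\<lambda>s. indicator {a..b} s * f s) \<in> borel_measurable borel"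
    using borel_measurable_continuous_on_indicator[OF _ f] by simp
  ultimately show ?thesis by (intro that[of C]) (auto simp: indicator_def)
qed

section \<open>Moment conditions and the kernel representation\<close>

text \<open>The three vanishing hypotheses in terms of the density: truncated powers replace
  variable upper limits, and constant factorials of plain monomials are dropped.\<close>

locale vanishing_moments =
  fixes a b c d :: real and M :: nat and Q :: "real \<times> real \<Rightarrow> real"
  assumes Q: "integrable lborel Q"
    and support: "\<And>w. w \<notin> {a..b} \<times> {c..d} \<Longrightarrow> Q w = 0"
    and moments: "\<And>i j. i \<le> M \<Longrightarrow> j \<le> M \<Longrightarrow>
      (\<integral>w. Q w * ((b - fst w) ^ i * (d - snd w) ^ j) \<partial>lborel) = 0"
    and moments_fst: "\<And>s j. s \<in> {a..b} \<Longrightarrow> j \<le> M \<Longrightarrow>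
      (\<integral>w. Q w * (trunc_power M s (fst w) * (d - snd w) ^ j) \<partial>lborel) = 0"
    and moments_snd: "\<And>t i. t \<in> {c..d} \<Longrightarrow> i \<le> M \<Longrightarrow>
      (\<integral>w. Q w * ((b - fst w) ^ i * trunc_power M t (snd w)) \<partial>lborel) = 0"
begin

text \<open>On the rectangle this is the function in the last hypothesis. Nothing is claimed about
  its sign elsewhere, so it will always appear with a factor supported on the rectangle.\<close>

definition kernel :: "real \<times> real \<Rightarrow> real" where
  "kernel v = (\<integral>w. Q w * (trunc_power M (fst v) (fst w) * trunc_power M (snd v) (snd w)) \<partial>lborel)"

lemma Q_measurable [measurable]: "Q \<in> borel_measurable borel"
  using Q by auto

lemma Fubini_on_support:
  fixes G :: "'b::euclidean_space \<Rightarrow> real \<times> real \<Rightarrow> real"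
  assumes S: "integrable lborel (indicator S :: 'b \<Rightarrow> real)"
    and G: "(\<lambda>(s, w). G s w) \<in> borel_measurable (lborel \<Otimes>\<^sub>M lborel)"
    and bound: "\<And>s w. w \<in> {a..b} \<times> {c..d} \<Longrightarrow> \<bar>G s w\<bar> \<le> C * indicator S s"
  shows "integrable lborel (\<lambda>w. Q w * (\<integral>s. G s w \<partial>lborel))"
    and "integrable lborel (\<lambda>s. \<integral>w. Q w * G s w \<partial>lborel)"
    and "(\<integral>w. Q w * (\<integral>s. G s w \<partial>lborel) \<partial>lborel) = (\<integral>s. \<integral>w. Q w * G s w \<partial>lborel \<partial>lborel)"
proof -
  have *: "\<bar>Q w * G s w\<bar> \<le> C * indicator S s * \<bar>Q w\<bar>" for s w
    using mult_left_mono[OF bound[of w s], of "\<bar>Q w\<bar>"] support[of w]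
    by (cases "w \<in> {a..b} \<times> {c..d}") (simp_all add: abs_mult mult_ac)
  note weighted_Fubini_lborel[OF Q S G *]
  then show "integrable lborel (\<lambda>w. Q w * (\<integral>s. G s w \<partial>lborel))"
    and "integrable lborel (\<lambda>s. \<integral>w. Q w * G s w \<partial>lborel)"
    and "(\<integral>w. Q w * (\<integral>s. G s w \<partial>lborel) \<partial>lborel) = (\<integral>s. \<integral>w. Q w * G s w \<partial>lborel \<partial>lborel)"
    by blast+
qed

lemma integrable_Q_bounded:
  assumes [measurable]: "h \<in> borel_measurable borel"
    and bound: "\<And>w. w \<in> {a..b} \<times> {c..d} \<Longrightarrow> \<bar>h w\<bar> \<le> C"
  shows "integrable lborel (\<lambda>w. Q w * h w)"
proof (rule Bochner_Integration.integrable_bound)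
  show "integrable lborel (\<lambda>w. C * \<bar>Q w\<bar>)" using Q by simp
  have "\<bar>Q w * h w\<bar> \<le> \<bar>C * \<bar>Q w\<bar>\<bar>" for w
  proof (cases "w \<in> {a..b} \<times> {c..d}")
    case True
    then have "\<bar>h w\<bar> \<le> \<bar>C\<bar>" using bound by fastforce
    from mult_left_mono[OF this, of "\<bar>Q w\<bar>"] show ?thesis by (simp add: abs_mult mult.commute)
  qed (simp add: support)
  then show "AE w in lborel. norm (Q w * h w) \<le> norm (C * \<bar>Q w\<bar>)" by simp
qed simp

text \<open>Once the \<open>s\<close>-integral is moved outside, the inner integral is a moment that
  vanishes for each \<open>s\<close> in the interval, and \<open>\<phi>\<close> vanishes at all
  other \<open>s\<close>.\<close>

lemma remainder_moments_fst:
  assumes [measurable]: "\<phi> \<in> borel_measurable borel"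
    and \<phi>: "\<And>s. \<bar>\<phi> s\<bar> \<le> C * indicator {a..b} s" and j: "j \<le> M"
  defines "R \<equiv> \<lambda>y. \<integral>s. \<phi> s * trunc_power M s y \<partial>lborel"
  shows "integrable lborel (\<lambda>w. Q w * (R (fst w) * (d - snd w) ^ j))"
    and "(\<integral>w. Q w * (R (fst w) * (d - snd w) ^ j) \<partial>lborel) = 0"
proof -
  define G where "G = (\<lambda>s w. \<phi> s * (trunc_power M s (fst w) * (d - snd w) ^ j))"
  have S: "integrable lborel (indicator {a..b} :: real \<Rightarrow> real)"
    by (intro integrable_indicator_compact compact_Icc)
  have G: "(\<lambda>(s, w). G s w) \<in> borel_measurable (lborel \<Otimes>\<^sub>M lborel)"
    unfolding G_def lborel_prod by measurable
  have bd: "\<bar>G s w\<bar> \<le> C * ((\<bar>b - a\<bar> ^ M / fact M) * \<bar>d - c\<bar> ^ j) * indicator {a..b} s"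
    if w: "w \<in> {a..b} \<times> {c..d}" for s w
  proof (cases "s \<in> {a..b}")
    case True
    have "\<bar>\<phi> s\<bar> * (\<bar>trunc_power M s (fst w)\<bar> * \<bar>d - snd w\<bar> ^ j)
        \<le> C * ((\<bar>b - a\<bar> ^ M / fact M) * \<bar>d - c\<bar> ^ j)"
      using \<phi>[of s] w True by (intro mult_mono trunc_power_bound power_mono) auto
    then show ?thesis using True by (simp add: G_def abs_mult power_abs)
  qed (use \<phi>[of s] in \<open>simp add: G_def\<close>)
  note fub = Fubini_on_support[OF S G bd]
  have R: "(\<integral>s. G s w \<partial>lborel) = R (fst w) * (d - snd w) ^ j" for w
    unfolding G_def R_def by (simp add: mult.assoc[symmetric])
  show "integrable lborel (\<lambda>w. Q w * (R (fst w) * (d - snd w) ^ j))"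
    using fub(1) by (simp add: R)
  have "(\<integral>w. Q w * G s w \<partial>lborel) = \<phi> s * (\<integral>w. Q w * (trunc_power M s (fst w) * (d - snd w) ^ j) \<partial>lborel)" for s
    unfolding G_def integral_mult_right_zero[symmetric] by (simp only: mult_ac)
  then have "(\<integral>w. Q w * G s w \<partial>lborel) = 0" for s
    using moments_fst[OF _ j, of s] \<phi>[of s] by (cases "s \<in> {a..b}") simp_all
  then show "(\<integral>w. Q w * (R (fst w) * (d - snd w) ^ j) \<partial>lborel) = 0"
    using fub(3) by (simp add: R)
qed

lemma remainder_moments_snd:
  assumes [measurable]: "\<gamma> \<in> borel_measurable borel"
    and \<gamma>: "\<And>t. \<bar>\<gamma> t\<bar> \<le> C * indicator {c..d} t" and i: "i \<le> M"
  defines "R \<equiv> \<lambda>z. \<integral>t. \<gamma> t * trunc_power M t z \<partial>lborel"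
  shows "integrable lborel (\<lambda>w. Q w * ((b - fst w) ^ i * R (snd w)))"
    and "(\<integral>w. Q w * ((b - fst w) ^ i * R (snd w)) \<partial>lborel) = 0"
proof -
  define G where "G = (\<lambda>t w. \<gamma> t * ((b - fst w) ^ i * trunc_power M t (snd w)))"
  have S: "integrable lborel (indicator {c..d} :: real \<Rightarrow> real)"
    by (intro integrable_indicator_compact compact_Icc)
  have G: "(\<lambda>(t, w). G t w) \<in> borel_measurable (lborel \<Otimes>\<^sub>M lborel)"
    unfolding G_def lborel_prod by measurable
  have bd: "\<bar>G t w\<bar> \<le> C * (\<bar>b - a\<bar> ^ i * (\<bar>d - c\<bar> ^ M / fact M)) * indicator {c..d} t"
    if w: "w \<in> {a..b} \<times> {c..d}" for t w
  proof (cases "t \<in> {c..d}")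
    case True
    have "\<bar>\<gamma> t\<bar> * (\<bar>b - fst w\<bar> ^ i * \<bar>trunc_power M t (snd w)\<bar>)
        \<le> C * (\<bar>b - a\<bar> ^ i * (\<bar>d - c\<bar> ^ M / fact M))"
      using \<gamma>[of t] w True by (intro mult_mono trunc_power_bound power_mono) auto
    then show ?thesis using True by (simp add: G_def abs_mult power_abs)
  qed (use \<gamma>[of t] in \<open>simp add: G_def\<close>)
  note fub = Fubini_on_support[OF S G bd]
  have R: "(\<integral>t. G t w \<partial>lborel) = (b - fst w) ^ i * R (snd w)" for w
    unfolding G_def R_def integral_mult_right_zero[symmetric] by (simp only: mult_ac)
  show "integrable lborel (\<lambda>w. Q w * ((b - fst w) ^ i * R (snd w)))"
    using fub(1) by (simp add: R)
  have "(\<integral>w. Q w * G t w \<partial>lborel) = \<gamma> t * (\<integral>w. Q w * ((b - fst w) ^ i * trunc_power M t (snd w)) \<partial>lborel)" for t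
    unfolding G_def integral_mult_right_zero[symmetric] by (simp only: mult_ac)
  then have "(\<integral>w. Q w * G t w \<partial>lborel) = 0" for t
    using moments_snd[OF _ i, of t] \<gamma>[of t] by (cases "t \<in> {c..d}") simp_all
  then show "(\<integral>w. Q w * ((b - fst w) ^ i * R (snd w)) \<partial>lborel) = 0"
    using fub(3) by (simp add: R)
qed

text \<open>Both remainders are merged into one integral over v = (s, t), so that a single exchange
  with the integral over \<open>w\<close> produces the kernel.\<close>

lemma remainder_moments_both:
  assumes [measurable]: "\<phi> \<in> borel_measurable borel" "\<gamma> \<in> borel_measurable borel"
    and \<phi>: "\<And>s. \<bar>\<phi> s\<bar> \<le> C * indicator {a..b} s"
    and \<gamma>: "\<And>t. \<bar>\<gamma> t\<bar> \<le> C' * indicator {c..d} t"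
  defines "R \<equiv> \<lambda>y. \<integral>s. \<phi> s * trunc_power M s y \<partial>lborel"
    and "R' \<equiv> \<lambda>z. \<integral>t. \<gamma> t * trunc_power M t z \<partial>lborel"
  shows "integrable lborel (\<lambda>w. Q w * (R (fst w) * R' (snd w)))"
    and "integrable lborel (\<lambda>v. \<phi> (fst v) * \<gamma> (snd v) * kernel v)"
    and "(\<integral>w. Q w * (R (fst w) * R' (snd w)) \<partial>lborel)
      = (\<integral>v. \<phi> (fst v) * \<gamma> (snd v) * kernel v \<partial>lborel)"
proof -
  define G where "G = (\<lambda>v w. (\<phi> (fst v) * trunc_power M (fst v) (fst w)) *
    (\<gamma> (snd v) * trunc_power M (snd v) (snd w)))"
  define B where "B = (C * (\<bar>b - a\<bar> ^ M / fact M)) * (C' * (\<bar>d - c\<bar> ^ M / fact M))"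
  have S: "integrable lborel (indicator ({a..b} \<times> {c..d}) :: real \<times> real \<Rightarrow> real)"
    by (intro integrable_indicator_compact compact_Times compact_Icc)
  have G: "(\<lambda>(v, w). G v w) \<in> borel_measurable (lborel \<Otimes>\<^sub>M lborel)"
    unfolding G_def lborel_prod by measurable
  have bd: "\<bar>G v w\<bar> \<le> B * indicator ({a..b} \<times> {c..d}) v"
    if w: "w \<in> {a..b} \<times> {c..d}" for v w
  proof (cases "v \<in> {a..b} \<times> {c..d}")
    case True
    have "(\<bar>\<phi> (fst v)\<bar> * \<bar>trunc_power M (fst v) (fst w)\<bar>) *
        (\<bar>\<gamma> (snd v)\<bar> * \<bar>trunc_power M (snd v) (snd w)\<bar>) \<le> B"
      unfolding B_def
      using \<phi>[of "fst v"] \<gamma>[of "snd v"] w True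
      by (intro mult_mono trunc_power_bound) auto
    then show ?thesis using True by (simp add: G_def abs_mult)
  next
    case False
    then have "\<phi> (fst v) = 0 \<or> \<gamma> (snd v) = 0"
      using \<phi>[of "fst v"] \<gamma>[of "snd v"] by (cases v) (auto simp: indicator_def split: if_splits)
    then show ?thesis using False by (auto simp: G_def)
  qed
  note fub = Fubini_on_support[OF S G bd]
  \<comment> \<open>The factor \<open>Q w\<close> stays in the identity because splitting the
    integral over \<open>v\<close> uses integrability that is available only for \<open>w\<close> in
    the rectangle.\<close>
  have R: "Q w * (\<integral>v. G v w \<partial>lborel) = Q w * (R (fst w) * R' (snd w))" for w
  proof (cases "w \<in> {a..b} \<times> {c..d}")
    case True
    then have "integrable lborel (\<lambda>s. \<phi> s * trunc_power M s (fst w))"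
      "integrable lborel (\<lambda>t. \<gamma> t * trunc_power M t (snd w))"
      by (auto intro!: integrable_bounded_trunc_power[OF _ \<phi>] integrable_bounded_trunc_power[OF _ \<gamma>])
    from integral_lborel_mult_fst_snd[OF this] show ?thesis
      by (simp add: G_def R_def R'_def)
  qed (simp add: support)
  have K: "(\<integral>w. Q w * G v w \<partial>lborel) = \<phi> (fst v) * \<gamma> (snd v) * kernel v" for v
  proof -
    have "(\<integral>w. Q w * G v w \<partial>lborel) = (\<integral>w. \<phi> (fst v) * \<gamma> (snd v) *
        (Q w * (trunc_power M (fst v) (fst w) * trunc_power M (snd v) (snd w))) \<partial>lborel)"
      by (simp add: G_def mult_ac)
    then show ?thesis by (simp add: kernel_def)
  qed
  show "integrable lborel (\<lambda>w. Q w * (R (fst w) * R' (snd w)))"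
    and "integrable lborel (\<lambda>v. \<phi> (fst v) * \<gamma> (snd v) * kernel v)"
    and "(\<integral>w. Q w * (R (fst w) * R' (snd w)) \<partial>lborel)
      = (\<integral>v. \<phi> (fst v) * \<gamma> (snd v) * kernel v \<partial>lborel)"
    using fub by (simp_all add: R K)
qed

text \<open>Of the four products of polynomial part and remainder only remainder times remainder
  survives. Both remainders carry the same factor \<open>\<sigma>\<close>, which in the application
  is a sign and disappears when squared.\<close>

lemma integral_product_eq_kernel:
  assumes m: "\<phi> \<in> borel_measurable borel" "\<gamma> \<in> borel_measurable borel"
    and \<phi>: "\<And>s. \<bar>\<phi> s\<bar> \<le> C * indicator {a..b} s"
    and \<gamma>: "\<And>t. \<bar>\<gamma> t\<bar> \<le> C' * indicator {c..d} t"
    and f: "\<And>y. y \<in> {a..b} \<Longrightarrow> f y = (\<Sum>i\<le>M. \<alpha> i * (b - y) ^ i)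
      + \<sigma> * (\<integral>s. \<phi> s * trunc_power M s y \<partial>lborel)"
    and g: "\<And>z. z \<in> {c..d} \<Longrightarrow> g z = (\<Sum>j\<le>M. \<beta> j * (d - z) ^ j)
      + \<sigma> * (\<integral>t. \<gamma> t * trunc_power M t z \<partial>lborel)"
  shows "integrable lborel (\<lambda>w. Q w * (f (fst w) * g (snd w)))"
    and "(\<integral>w. Q w * (f (fst w) * g (snd w)) \<partial>lborel)
      = \<sigma>\<^sup>2 * (\<integral>v. \<phi> (fst v) * \<gamma> (snd v) * kernel v \<partial>lborel)"
proof -
  define R where "R y = (\<integral>s. \<phi> s * trunc_power M s y \<partial>lborel)" for y
  define R' where "R' z = (\<integral>t. \<gamma> t * trunc_power M t z \<partial>lborel)" for z
  have eq: "Q w * (f (fst w) * g (snd w)) =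
      (\<Sum>i\<le>M. \<Sum>j\<le>M. \<alpha> i * \<beta> j * (Q w * ((b - fst w) ^ i * (d - snd w) ^ j)))
      + \<sigma> * (\<Sum>j\<le>M. \<beta> j * (Q w * (R (fst w) * (d - snd w) ^ j)))
      + \<sigma> * (\<Sum>i\<le>M. \<alpha> i * (Q w * ((b - fst w) ^ i * R' (snd w))))
      + \<sigma>\<^sup>2 * (Q w * (R (fst w) * R' (snd w)))" for w
  proof (cases "w \<in> {a..b} \<times> {c..d}")
    case True
    then have fw: "f (fst w) = (\<Sum>i\<le>M. \<alpha> i * (b - fst w) ^ i) + \<sigma> * R (fst w)"
      and gw: "g (snd w) = (\<Sum>j\<le>M. \<beta> j * (d - snd w) ^ j) + \<sigma> * R' (snd w)"
      using f[of "fst w"] g[of "snd w"] by (auto simp: R_def R'_def)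
    have "(\<Sum>i\<le>M. \<Sum>j\<le>M. \<alpha> i * \<beta> j * (Q w * ((b - fst w) ^ i * (d - snd w) ^ j)))
        = Q w * ((\<Sum>i\<le>M. \<alpha> i * (b - fst w) ^ i) * (\<Sum>j\<le>M. \<beta> j * (d - snd w) ^ j))"
      unfolding sum_product by (simp add: sum_distrib_left mult_ac)
    moreover have "(\<Sum>j\<le>M. \<beta> j * (Q w * (R (fst w) * (d - snd w) ^ j)))
        = Q w * (R (fst w) * (\<Sum>j\<le>M. \<beta> j * (d - snd w) ^ j))"
      by (simp add: sum_distrib_left mult_ac)
    moreover have "(\<Sum>i\<le>M. \<alpha> i * (Q w * ((b - fst w) ^ i * R' (snd w))))
        = Q w * ((\<Sum>i\<le>M. \<alpha> i * (b - fst w) ^ i) * R' (snd w))"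
      by (simp add: sum_distrib_left sum_distrib_right mult_ac)
    ultimately show ?thesis unfolding fw gw by (simp add: algebra_simps power2_eq_square)
  qed (simp add: support)
  have int: "integrable lborel (\<lambda>w. Q w * ((b - fst w) ^ i * (d - snd w) ^ j))" for i j
  proof (rule integrable_Q_bounded[where C = "\<bar>b - a\<bar> ^ i * \<bar>d - c\<bar> ^ j"])
    show "\<bar>(b - fst w) ^ i * (d - snd w) ^ j\<bar> \<le> \<bar>b - a\<bar> ^ i * \<bar>d - c\<bar> ^ j"
      if "w \<in> {a..b} \<times> {c..d}" for w
      using that by (auto simp: abs_mult power_abs intro!: mult_mono power_mono)
  qed simp
  note fst = remainder_moments_fst[OF m(1) \<phi>, folded R_def]
    and snd = remainder_moments_snd[OF m(2) \<gamma>, folded R'_def]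
    and both = remainder_moments_both[OF m \<phi> \<gamma>, folded R_def R'_def]
  have int1: "integrable lborel (\<lambda>w. \<Sum>i\<le>M. \<Sum>j\<le>M. \<alpha> i * \<beta> j * (Q w * ((b - fst w) ^ i * (d - snd w) ^ j)))"
    and int2: "integrable lborel (\<lambda>w. \<sigma> * (\<Sum>j\<le>M. \<beta> j * (Q w * (R (fst w) * (d - snd w) ^ j))))"
    and int3: "integrable lborel (\<lambda>w. \<sigma> * (\<Sum>i\<le>M. \<alpha> i * (Q w * ((b - fst w) ^ i * R' (snd w)))))"
    and int4: "integrable lborel (\<lambda>w. \<sigma>\<^sup>2 * (Q w * (R (fst w) * R' (snd w))))"
    by (auto intro!: Bochner_Integration.integrable_sum integrable_mult_right int fst(1) snd(1) both(1))
  show "integrable lborel (\<lambda>w. Q w * (f (fst w) * g (snd w)))"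
    unfolding eq by (intro Bochner_Integration.integrable_add int1 int2 int3 int4)
  have "(\<integral>w. (\<Sum>i\<le>M. \<Sum>j\<le>M. \<alpha> i * \<beta> j * (Q w * ((b - fst w) ^ i * (d - snd w) ^ j))) \<partial>lborel) = 0"
    using int by (simp add: moments)
  moreover have "(\<integral>w. \<sigma> * (\<Sum>j\<le>M. \<beta> j * (Q w * (R (fst w) * (d - snd w) ^ j))) \<partial>lborel) = 0"
    by (simp add: fst)
  moreover have "(\<integral>w. \<sigma> * (\<Sum>i\<le>M. \<alpha> i * (Q w * ((b - fst w) ^ i * R' (snd w)))) \<partial>lborel) = 0"
    by (simp add: snd)
  ultimately show "(\<integral>w. Q w * (f (fst w) * g (snd w)) \<partial>lborel)
      = \<sigma>\<^sup>2 * (\<integral>v. \<phi> (fst v) * \<gamma> (snd v) * kernel v \<partial>lborel)"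
    unfolding eq using both int1 int2 int3 int4
    by (simp only: Bochner_Integration.integral_add Bochner_Integration.integrable_add
      integral_mult_right_zero add_0)
qed

text \<open>Applied to negative powers, this makes the weight of the exponential mixture
  integrable.\<close>

lemma integrable_kernel_product:
  assumes f: "continuous_on {a..b} f" and g: "continuous_on {c..d} g"
  shows "integrable lborel (\<lambda>v. indicator ({a..b} \<times> {c..d}) v * (f (fst v) * g (snd v)) * kernel v)"
proof -
  obtain C where \<phi>: "(\<lambda>s. indicator {a..b} s * f s) \<in> borel_measurable borel"
      "\<And>s. \<bar>indicator {a..b} s * f s\<bar> \<le> C * indicator {a..b} s"
    using indicator_times_continuous[OF f] by blast
  obtain C' where \<gamma>: "(\<lambda>t. indicator {c..d} t * g t) \<in> borel_measurable borel"
      "\<And>t. \<bar>indicator {c..d} t * g t\<bar> \<le> C' * indicator {c..d} t"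
    using indicator_times_continuous[OF g] by blast
  have "indicator {a..b} (fst v) * f (fst v) * (indicator {c..d} (snd v) * g (snd v))
      = indicator ({a..b} \<times> {c..d}) v * (f (fst v) * g (snd v))" for v
    by (cases v) (auto simp: indicator_def)
  then show ?thesis using remainder_moments_both(2)[OF \<phi>(1) \<gamma>(1) \<phi>(2) \<gamma>(2)] by (simp only:)
qed

lemma integral_derivatives_eq_kernel:
  fixes D E :: "nat \<Rightarrow> real \<Rightarrow> real"
  assumes D: "\<And>i s. i \<le> M \<Longrightarrow> s \<in> {a..b} \<Longrightarrow> (D i has_field_derivative D (Suc i) s) (at s within {a..b})"
    and contD: "continuous_on {a..b} (D (Suc M))"
    and E: "\<And>i t. i \<le> M \<Longrightarrow> t \<in> {c..d} \<Longrightarrow> (E i has_field_derivative E (Suc i) t) (at t within {c..d})"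
    and contE: "continuous_on {c..d} (E (Suc M))"
  shows "integrable lborel (\<lambda>w. Q w * (D 0 (fst w) * E 0 (snd w)))" (is ?int)
    and "(\<integral>w. Q w * (D 0 (fst w) * E 0 (snd w)) \<partial>lborel) =
      (\<integral>v. indicator ({a..b} \<times> {c..d}) v * (D (Suc M) (fst v) * E (Suc M) (snd v)) * kernel v \<partial>lborel)"
      (is ?eq)
proof -
  define \<phi> where "\<phi> = (\<lambda>s. indicator {a..b} s * D (Suc M) s)"
  define \<gamma> where "\<gamma> = (\<lambda>t. indicator {c..d} t * E (Suc M) t)"
  obtain C where \<phi>: "\<phi> \<in> borel_measurable borel" "\<And>s. \<bar>\<phi> s\<bar> \<le> C * indicator {a..b} s"
    using indicator_times_continuous[OF contD] unfolding \<phi>_def by blast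
  obtain C' where \<gamma>: "\<gamma> \<in> borel_measurable borel" "\<And>t. \<bar>\<gamma> t\<bar> \<le> C' * indicator {c..d} t"
    using indicator_times_continuous[OF contE] unfolding \<gamma>_def by blast
  have ind: "\<phi> (fst v) * \<gamma> (snd v)
      = indicator ({a..b} \<times> {c..d}) v * (D (Suc M) (fst v) * E (Suc M) (snd v))" for v
    by (cases v) (auto simp: \<phi>_def \<gamma>_def indicator_def)
  have f: "D 0 y = (\<Sum>i\<le>M. ((-1) ^ i * D i b / fact i) * (b - y) ^ i)
      + (-1) ^ Suc M * (\<integral>s. \<phi> s * trunc_power M s y \<partial>lborel)" if "y \<in> {a..b}" for y
    unfolding \<phi>_def by (rule Taylor_right_endpoint[OF that D contD])
  have g: "E 0 z = (\<Sum>i\<le>M. ((-1) ^ i * E i d / fact i) * (d - z) ^ i)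
      + (-1) ^ Suc M * (\<integral>t. \<gamma> t * trunc_power M t z \<partial>lborel)" if "z \<in> {c..d}" for z
    unfolding \<gamma>_def by (rule Taylor_right_endpoint[OF that E contE])
  have sign: "((-1 :: real) ^ Suc M)\<^sup>2 = 1" by (simp flip: power_mult)
  note eqs = integral_product_eq_kernel[of \<phi> \<gamma> C C' "D 0" _ "(-1) ^ Suc M" "E 0", OF \<phi>(1) \<gamma>(1) \<phi>(2) \<gamma>(2) f g]
  show ?int by (rule eqs(1))
  show ?eq using eqs(2) by (simp only: ind sign mult_1)
qed

end

section \<open>Powers and logarithms\<close>

text \<open>Started at (A, B, C), step i of the recursion gives the coefficients of the i-th derivative of
  u^q (A + B ln u + C (ln u)^2), which is again such an expression with q - i in place of q.\<close>
primrec log_power_coeffs :: "real \<Rightarrow> real \<times> real \<times> real \<Rightarrow> nat \<Rightarrow> real \<times> real \<times> real" where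
  "log_power_coeffs q p 0 = p"
| "log_power_coeffs q p (Suc i) = (case log_power_coeffs q p i of (A, B, C) \<Rightarrow>
    ((q - real i) * A + B, (q - real i) * B + 2 * C, (q - real i) * C))"

definition log_power :: "real \<Rightarrow> real \<times> real \<times> real \<Rightarrow> nat \<Rightarrow> real \<Rightarrow> real" where
  "log_power q p i u = (case log_power_coeffs q p i of (A, B, C) \<Rightarrow>
    (A + B * ln u + C * (ln u)\<^sup>2) * u powr (q - real i))"

lemma log_power_deriv:
  assumes u: "u > 0"
  shows "(log_power q p i has_field_derivative log_power q p (Suc i) u) (at u)"
proof -
  obtain A B C where p: "log_power_coeffs q p i = (A, B, C)" by (metis prod_cases3)
  let ?r = "q - real i"
  have fac: "u powr ?r = u * u powr (?r - 1)"
    using u by (simp add: powr_diff)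
  have ln2: "((\<lambda>u. (ln u)\<^sup>2) has_field_derivative 2 * ln u * (1 / u)) (at u)"
    using u by (auto intro!: derivative_eq_intros)
  have lin: "((\<lambda>u. A + B * ln u + C * (ln u)\<^sup>2) has_field_derivative
      B * (1 / u) + C * (2 * ln u * (1 / u))) (at u)"
    using u by (auto intro!: derivative_eq_intros ln2)
  have "((\<lambda>u. (A + B * ln u + C * (ln u)\<^sup>2) * u powr ?r) has_field_derivative
      (B * (1 / u) + C * (2 * ln u * (1 / u))) * u powr ?r
      + ?r * u powr (?r - 1) * (A + B * ln u + C * (ln u)\<^sup>2)) (at u)"
    by (rule DERIV_mult[OF lin has_real_derivative_powr[OF u]])
  also have "(B * (1 / u) + C * (2 * ln u * (1 / u))) * u powr ?r
      + ?r * u powr (?r - 1) * (A + B * ln u + C * (ln u)\<^sup>2)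
      = ((?r * A + B) + (?r * B + 2 * C) * ln u + ?r * C * (ln u)\<^sup>2) * u powr (?r - 1)"
    unfolding fac using u by (simp add: field_simps)
  also have "\<dots> = log_power q p (Suc i) u"
    by (simp add: log_power_def p algebra_simps)
  finally show ?thesis by (simp add: log_power_def[abs_def] p)
qed

lemma log_power_0: "log_power q (A, B, C) 0 u = (A + B * ln u + C * (ln u)\<^sup>2) * u powr q"
  by (simp add: log_power_def)

lemma log_power_shift_deriv:
  assumes "s + k > 0"
  shows "((\<lambda>s. log_power q p i (s + k)) has_field_derivative log_power q p (Suc i) (s + k)) (at s within S)"
proof -
  have "((\<lambda>s. s + k) has_field_derivative 1) (at s within S)"
    by (auto intro!: derivative_eq_intros)
  from DERIV_chain2[of "log_power q p i" _ "\<lambda>s. s + k", OF log_power_deriv[OF assms] this]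
  show ?thesis by simp
qed

lemma continuous_on_log_power_shift:
  assumes "\<And>s. s \<in> S \<Longrightarrow> s + k > 0"
  shows "continuous_on S (\<lambda>s. log_power q p i (s + k))"
  by (rule DERIV_continuous_on, rule log_power_shift_deriv, rule assms)

text \<open>The coefficient is a falling factorial, which is zero exactly if \<open>q\<close> is one
  of 0, ..., i - 1.\<close>

lemma log_power_coeffs_power:
  "log_power_coeffs q (1, 0, 0) i = (\<Prod>j<i. q - real j, 0, 0)"
  by (induction i) (auto simp: mult.commute)

text \<open>\<open>A\<close> can stay unspecified: for \<open>q = real i\<close> the next step of
  the recursion multiplies it by zero.\<close>

lemma log_power_coeffs_ln:
  "\<exists>A. log_power_coeffs q (0, 1, 0) i = (A, \<Prod>j<i. q - real j, 0)"
  by (induction i) (auto simp: mult.commute)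

text \<open>After n steps ln u has the coefficient n!. The factor n - n = 0 in the next step removes
  the logarithm and leaves n!/u, whose further derivatives contribute -1, -2, ..., -k.\<close>

lemma log_power_coeffs_ln_above:
  "log_power_coeffs (real n) (0, 1, 0) (Suc (n + k)) = ((-1) ^ k * fact n * fact k, 0, 0)"
proof (induction k)
  case 0
  have "(\<Prod>j<n. real n - real j) = (\<Prod>j<n. real (n - j))"
    by (intro prod.cong) (auto simp: of_nat_diff)
  also have "\<dots> = fact n"
    unfolding fact_prod_rev of_nat_prod lessThan_atLeast0 ..
  finally show ?case
    using log_power_coeffs_ln[of "real n" n] by auto
next
  case (Suc k)
  then show ?case by (simp add: algebra_simps)
qed

section \<open>The normalisation of \<open>psi\<close>\<close>

context vanishing_moments
begin

lemma integral_log_powers: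
  assumes k1: "\<And>y. y \<in> {a..b} \<Longrightarrow> y + k1 > 0" and k2: "\<And>z. z \<in> {c..d} \<Longrightarrow> z + k2 > 0"
  shows "integrable lborel (\<lambda>w. Q w * (log_power q p 0 (fst w + k1) * log_power r p' 0 (snd w + k2)))"
    and "(\<integral>w. Q w * (log_power q p 0 (fst w + k1) * log_power r p' 0 (snd w + k2)) \<partial>lborel)
      = (\<integral>v. indicator ({a..b} \<times> {c..d}) v *
      (log_power q p (Suc M) (fst v + k1) * log_power r p' (Suc M) (snd v + k2)) * kernel v \<partial>lborel)"
  by (rule integral_derivatives_eq_kernel[where D = "\<lambda>i s. log_power q p i (s + k1)"
        and E = "\<lambda>i t. log_power r p' i (t + k2)"];
      intro log_power_shift_deriv continuous_on_log_power_shift k1 k2; assumption)+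

text \<open>\<open>psi\<close> is a combination of products of functions of one variable, to each of
  which the kernel representation applies. If the derivatives of order M + 1 are bare powers, all
  that remains is the product of their coefficients, which the denominator of \<open>psi\<close>
  cancels.\<close>

lemma integral_psi:
  assumes k1: "\<And>y. y \<in> {a..b} \<Longrightarrow> y + k1 > 0" and k2: "\<And>z. z \<in> {c..d} \<Longrightarrow> z - k2 > 0"
  shows "(\<integral>w. Q w * psi M k1 k2 q w \<partial>lborel) = (\<integral>v. indicator ({a..b} \<times> {c..d}) v *
      ((fst v + k1) powr (q - real (Suc M)) * (snd v - k2) powr (q - real (Suc M))) * kernel v \<partial>lborel)"
    (is "_ = ?rhs")
proof -
  let ?L = "\<lambda>p p'. \<integral>w. Q w * (log_power q p 0 (fst w + k1) * log_power q p' 0 (snd w + (- k2))) \<partial>lborel"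
  let ?p = "\<Prod>j<Suc M. q - real j"
  have k2': "z + (- k2) > 0" if "z \<in> {c..d}" for z using k2[OF that] by simp
  have int: "integrable lborel (\<lambda>w. Q w * (log_power q p 0 (fst w + k1) * log_power q p' 0 (snd w + (- k2))))" for p p'
    by (rule integral_log_powers(1)[OF k1 k2'])
  have eq: "?L p p' = (\<integral>v. indicator ({a..b} \<times> {c..d}) v *
      (log_power q p (Suc M) (fst v + k1) * log_power q p' (Suc M) (snd v + (- k2))) * kernel v \<partial>lborel)" for p p'
    by (rule integral_log_powers(2)[OF k1 k2'])
  have scaled: "?L p p' = A * B * ?rhs"
    if "log_power_coeffs q p (Suc M) = (A, 0, 0)" "log_power_coeffs q p' (Suc M) = (B, 0, 0)" for p p' A B
  proof -
    have "?L p p' = (\<integral>v. A * B * (indicator ({a..b} \<times> {c..d}) v *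
      ((fst v + k1) powr (q - real (Suc M)) * (snd v - k2) powr (q - real (Suc M))) * kernel v) \<partial>lborel)"
      unfolding eq by (intro Bochner_Integration.integral_cong)
        (simp_all add: log_power_def that mult_ac del: log_power_coeffs.simps)
    then show ?thesis by simp
  qed
  have vanish: "?L p p' = 0"
    if "log_power_coeffs q p (Suc M) = (0, 0, 0) \<or> log_power_coeffs q p' (Suc M) = (0, 0, 0)" for p p'
  proof -
    have "log_power q p (Suc M) u * log_power q p' (Suc M) v = 0" for u v
      using that by (auto simp: log_power_def simp del: log_power_coeffs.simps)
    then show ?thesis unfolding eq by (simp only: mult_zero_left mult_zero_right integral_zero)
  qed
  show ?thesis
  proof (cases "q \<in> real ` {0..M}")
    case False
    then have "?p \<noteq> 0" by (auto simp: image_iff)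
    have "Q w * psi M k1 k2 q w = 1 / ?p\<^sup>2 *
        (Q w * (log_power q (1, 0, 0) 0 (fst w + k1) * log_power q (1, 0, 0) 0 (snd w + (- k2))))" for w
      using False by (simp add: psi_def log_power_0 split_beta atLeast0AtMost lessThan_Suc_atMost)
    then have "(\<integral>w. Q w * psi M k1 k2 q w \<partial>lborel) = 1 / ?p\<^sup>2 * ?L (1, 0, 0) (1, 0, 0)"
      by (simp only: integral_mult_right_zero)
    also have "\<dots> = ?rhs"
      using \<open>?p \<noteq> 0\<close> by (simp only: scaled[OF log_power_coeffs_power log_power_coeffs_power])
        (simp add: power2_eq_square)
    finally show ?thesis .
  next
    case True
    then obtain n where n: "q = real n" "n \<le> M" by auto
    \<comment> \<open>In the expansion of the square of ln (u v) = ln u + ln v only the mixed term survives, as the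
      derivative of order M + 1 kills the bare powers of degree n.\<close>
    define e :: real where "e = fact n * fact (M - n)"
    have e: "e \<noteq> 0" by (simp add: e_def)
    have "Q w * psi M k1 k2 q w = 1 / (2 * e\<^sup>2) *
        (Q w * (log_power q (0, 0, 1) 0 (fst w + k1) * log_power q (1, 0, 0) 0 (snd w + (- k2)))
        + 2 * (Q w * (log_power q (0, 1, 0) 0 (fst w + k1) * log_power q (0, 1, 0) 0 (snd w + (- k2))))
        + Q w * (log_power q (1, 0, 0) 0 (fst w + k1) * log_power q (0, 0, 1) 0 (snd w + (- k2))))" for w
    proof (cases "w \<in> {a..b} \<times> {c..d}")
      case w: True
      then have "fst w + k1 > 0" "snd w - k2 > 0" using k1[of "fst w"] k2[of "snd w"] by auto
      then have "ln ((fst w + k1) * (snd w - k2)) = ln (fst w + k1) + ln (snd w - k2)"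
        by (simp add: ln_mult)
      then have "psi M k1 k2 q w = (fst w + k1) powr q * (snd w - k2) powr q *
          (ln (fst w + k1) + ln (snd w - k2))\<^sup>2 / (2 * e\<^sup>2)"
        using n by (simp add: psi_def split_beta e_def)
      then show ?thesis
        by (simp add: log_power_0 power2_sum algebra_simps add_divide_distrib)
    qed (simp add: support)
    then have "(\<integral>w. Q w * psi M k1 k2 q w \<partial>lborel) = 1 / (2 * e\<^sup>2) *
        (?L (0, 0, 1) (1, 0, 0) + 2 * ?L (0, 1, 0) (0, 1, 0) + ?L (1, 0, 0) (0, 0, 1))"
      using int by simp
    also have "?L (0, 0, 1) (1, 0, 0) = 0"
      by (rule vanish) (use n in \<open>auto simp: log_power_coeffs_power simp del: log_power_coeffs.simps\<close>)
    also have "?L (1, 0, 0) (0, 0, 1) = 0"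
      by (rule vanish) (use n in \<open>auto simp: log_power_coeffs_power simp del: log_power_coeffs.simps\<close>)
    \<comment> \<open>Both coefficients equal \<open>(-1) ^ (M - n) * e\<close>, so the sign squares
      away; the 2 of the mixed term then completes the cancellation of the denominator.\<close>
    also have "?L (0, 1, 0) (0, 1, 0) = e\<^sup>2 * ?rhs"
    proof -
      have "log_power_coeffs q (0, 1, 0) (Suc M) = ((-1) ^ (M - n) * e, 0, 0)"
        using log_power_coeffs_ln_above[of n "M - n"] n
        by (simp add: e_def mult.assoc del: log_power_coeffs.simps)
      from scaled[OF this this] show ?thesis
        by (simp add: power2_eq_square mult_ac flip: power_add)
    qed
    finally show ?thesis using e by simp
  qed
qed

end

section \<open>From the hypotheses to an exponential mixture\<close>

lemma continuous_on_psi: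
  assumes "\<And>y z. y \<in> {a..b} \<Longrightarrow> z \<in> {c..d} \<Longrightarrow> y + k1 > 0 \<and> z - k2 > 0"
  shows "continuous_on ({a..b} \<times> {c..d}) (psi M k1 k2 q)"
proof -
  have pos: "fst w + k1 > 0 \<and> snd w - k2 > 0" if "w \<in> {a..b} \<times> {c..d}" for w
    using assms that by auto
  have "q \<in> real ` {0..M} \<or> (\<Prod>i = 0..M. q - real i) \<noteq> 0" by (auto simp: image_iff)
  then show ?thesis
    unfolding psi_def split_beta Let_def
    by (cases "q \<in> real ` {0..M}")
      (auto simp del: mem_Times_iff dest!: pos intro!: continuous_intros)
qed

text \<open>In the kernel representation the exponent q - M - 1 is split: the part -(M + 1) goes
  into the weight together with the kernel, and the power q becomes exp(q L) with L the logarithm of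
  (y + k1)(z - k2).\<close>

lemma Lambda_psi_exponential_mixture:
  fixes a b c d k1 k2 :: real and M :: nat and P :: "real \<times> real \<Rightarrow> real"
  assumes ab: "a \<le> b" and cd: "c \<le> d"
    and pos: "\<And>y z. y \<in> {a..b} \<Longrightarrow> z \<in> {c..d} \<Longrightarrow> y + k1 > 0 \<and> z - k2 > 0"
    and P: "set_integrable lebesgue ({a..b} \<times> {c..d}) P"
    and moments: "\<And>i j. i \<in> {0..M} \<Longrightarrow> j \<in> {0..M} \<Longrightarrow>
      iterated_integral a b c d
        (\<lambda>(y, z). P (y, z) * ((b - y) ^ i / fact i) * ((d - z) ^ j / fact j)) = 0"
    and moments_fst: "\<And>j s. j \<in> {0..M} \<Longrightarrow> s \<in> {a..b} \<Longrightarrow>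
      iterated_integral a s c d
        (\<lambda>(y, z). P (y, z) * ((s - y) ^ M / fact M) * ((d - z) ^ j / fact j)) = 0"
    and moments_snd: "\<And>i t. i \<in> {0..M} \<Longrightarrow> t \<in> {c..d} \<Longrightarrow>
      iterated_integral a b c t
        (\<lambda>(y, z). P (y, z) * ((b - y) ^ i / fact i) * ((t - z) ^ M / fact M)) = 0"
    and kernel_nonneg: "\<And>s t. s \<in> {a..b} \<Longrightarrow> t \<in> {c..d} \<Longrightarrow>
      iterated_integral a s c t
        (\<lambda>(y, z). P (y, z) * ((s - y) ^ M / fact M) * ((t - z) ^ M / fact M)) \<ge> 0"
  obtains k L B where
    "exponential_mixture (lborel :: (real \<times> real) measure) k L B (\<lambda>q. Lambda a b c d P (psi M k1 k2 q))"
proof -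
  let ?R = "{a..b} \<times> {c..d}"
  obtain Q where Q: "integrable lborel Q" and supp: "\<And>w. w \<notin> ?R \<Longrightarrow> Q w = 0"
    and dens: "\<And>s t h. s \<le> b \<Longrightarrow> t \<le> d \<Longrightarrow> continuous_on ?R h \<Longrightarrow>
      iterated_integral a s c t (\<lambda>w. P w * h w) =
        (\<integral>w. Q w * (indicator ({..s} \<times> {..t}) w * h w) \<partial>lborel)"
    using iterated_integral_borel_density[OF P] by blast
  \<comment> \<open>\<open>F\<close> and \<open>G\<close> stand for the factors with the cut-off at
    \<open>s\<close> and \<open>t\<close> built in: a truncated power for a variable limit, the
    monomial itself for the limit \<open>b\<close> or \<open>d\<close>.\<close>
  have product: "iterated_integral a s c t (\<lambda>(y, z). P (y, z) * f y * g z)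
      = (\<integral>w. Q w * (F (fst w) * G (snd w)) \<partial>lborel)"
    if "s \<le> b" "t \<le> d" "continuous_on UNIV f" "continuous_on UNIV g"
      and F: "\<And>y. y \<in> {a..b} \<Longrightarrow> F y = indicator {..s} y * f y"
      and G: "\<And>z. z \<in> {c..d} \<Longrightarrow> G z = indicator {..t} z * g z"
    for s t :: real and f g F G :: "real \<Rightarrow> real"
  proof -
    have "continuous_on ?R (\<lambda>w. f (fst w) * g (snd w))"
      by (intro continuous_intros continuous_on_compose2[OF that(3)] continuous_on_compose2[OF that(4)]) auto
    from dens[OF that(1,2) this]
    have "iterated_integral a s c t (\<lambda>(y, z). P (y, z) * f y * g z)
      = (\<integral>w. Q w * (indicator ({..s} \<times> {..t}) w * (f (fst w) * g (snd w))) \<partial>lborel)"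
      by (simp add: case_prod_unfold mult.assoc)
    also have "\<dots> = (\<integral>w. Q w * (F (fst w) * G (snd w)) \<partial>lborel)"
    proof (rule Bochner_Integration.integral_cong[OF refl])
      fix w
      show "Q w * (indicator ({..s} \<times> {..t}) w * (f (fst w) * g (snd w))) = Q w * (F (fst w) * G (snd w))"
        using F[of "fst w"] G[of "snd w"] supp[of w]
        by (cases "w \<in> ?R") (auto simp: indicator_def)
    qed
    finally show ?thesis .
  qed
  have monom: "continuous_on UNIV (\<lambda>x :: real. (r - x) ^ i / fact i)" for r and i :: nat
    by (intro continuous_intros) simp
  have vm: "vanishing_moments a b c d M Q"
  proof
    fix i j assume ij: "i \<le> M" "j \<le> M"
    have "0 = (\<integral>w. Q w * ((b - fst w) ^ i / fact i * ((d - snd w) ^ j / fact j)) \<partial>lborel)"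
      using moments[of i j] ij
        product[OF order_refl order_refl monom[of b i] monom[of d j],
          of "\<lambda>y. (b - y) ^ i / fact i" "\<lambda>z. (d - z) ^ j / fact j"] by simp
    also have "\<dots> = (\<integral>w. 1 / (fact i * fact j) * (Q w * ((b - fst w) ^ i * (d - snd w) ^ j)) \<partial>lborel)"
      by (simp add: mult_ac)
    finally show "(\<integral>w. Q w * ((b - fst w) ^ i * (d - snd w) ^ j) \<partial>lborel) = 0"
      by simp
  next
    fix s j assume sj: "s \<in> {a..b}" "j \<le> M"
    then have "0 = (\<integral>w. Q w * (trunc_power M s (fst w) * ((d - snd w) ^ j / fact j)) \<partial>lborel)"
      using moments_fst[of j s]
        product[OF _ order_refl monom[of s M] monom[of d j],
          of s "trunc_power M s" "\<lambda>z. (d - z) ^ j / fact j"]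
      by (simp add: trunc_power_def indicator_def)
    also have "\<dots> = (\<integral>w. 1 / fact j * (Q w * (trunc_power M s (fst w) * (d - snd w) ^ j)) \<partial>lborel)"
      by (simp add: mult_ac)
    finally show "(\<integral>w. Q w * (trunc_power M s (fst w) * (d - snd w) ^ j) \<partial>lborel) = 0"
      by simp
  next
    fix t i assume ti: "t \<in> {c..d}" "i \<le> M"
    then have "0 = (\<integral>w. Q w * ((b - fst w) ^ i / fact i * trunc_power M t (snd w)) \<partial>lborel)"
      using moments_snd[of i t]
        product[OF order_refl _ monom[of b i] monom[of t M],
          of t "\<lambda>y. (b - y) ^ i / fact i" "trunc_power M t"]
      by (simp add: trunc_power_def indicator_def)
    also have "\<dots> = (\<integral>w. 1 / fact i * (Q w * ((b - fst w) ^ i * trunc_power M t (snd w))) \<partial>lborel)"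
      by (simp add: mult_ac)
    finally show "(\<integral>w. Q w * ((b - fst w) ^ i * trunc_power M t (snd w)) \<partial>lborel) = 0"
      by simp
  qed (use Q supp in auto)
  then interpret vanishing_moments a b c d M Q .
  have kernel: "kernel v \<ge> 0" if "v \<in> ?R" for v
    using that kernel_nonneg[of "fst v" "snd v"]
      product[OF _ _ monom[of "fst v" M] monom[of "snd v" M],
        of "fst v" "snd v" "trunc_power M (fst v)" "trunc_power M (snd v)"]
    by (auto simp: trunc_power_def indicator_def kernel_def)
  have k1: "y + k1 > 0" if "y \<in> {a..b}" for y using pos[OF that, of c] cd by simp
  have k2: "z - k2 > 0" if "z \<in> {c..d}" for z using pos[OF _ that, of a] ab by simp
  define k where "k = (\<lambda>v. indicator ?R v *
    ((fst v + k1) powr (- real (Suc M)) * (snd v - k2) powr (- real (Suc M))) * kernel v)"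
  define L where "L = (\<lambda>v. indicator ?R v * ln ((fst v + k1) * (snd v - k2)))"
  have compR: "compact ?R" by (intro compact_Times compact_Icc)
  have contL: "continuous_on ?R (\<lambda>v. ln ((fst v + k1) * (snd v - k2)))"
  proof (intro continuous_intros ballI)
    show "(fst v + k1) * (snd v - k2) \<noteq> 0" if "v \<in> ?R" for v
      using k1[of "fst v"] k2[of "snd v"] that by auto
  qed
  obtain B where B: "\<forall>x\<in>(\<lambda>v. ln ((fst v + k1) * (snd v - k2))) ` ?R. norm x \<le> B"
    using compact_imp_bounded[OF compact_continuous_image[OF contL compR]]
    unfolding bounded_iff by blast
  \<comment> \<open>The absolute value of \<open>B\<close> is nonnegative, as is required outside
    the rectangle, where \<open>L\<close> is 0.\<close>
  have "exponential_mixture (lborel :: (real \<times> real) measure) k L \<bar>B\<bar> (\<lambda>q. Lambda a b c d P (psi M k1 k2 q))"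
  proof
    show "integrable lborel k"
      unfolding k_def
    proof (rule integrable_kernel_product[where f = "\<lambda>y. (y + k1) powr _" and g = "\<lambda>z. (z - k2) powr _"])
      show "continuous_on {a..b} (\<lambda>y. (y + k1) powr - real (Suc M))"
        by (intro continuous_intros) (use k1 in force)
      show "continuous_on {c..d} (\<lambda>z. (z - k2) powr - real (Suc M))"
        by (intro continuous_intros) (use k2 in force)
    qed
    show "k v \<ge> 0" for v
      using kernel[of v] by (cases "v \<in> ?R") (auto simp: k_def)
    show "L \<in> borel_measurable lborel"
      using borel_measurable_continuous_on_indicator[OF borel_compact[OF compR] contL]
      by (simp add: L_def)
    show "\<bar>L v\<bar> \<le> \<bar>B\<bar>" for v
      using B by (cases "v \<in> ?R") (force simp: L_def)+
    fix q
    have "Lambda a b c d P (psi M k1 k2 q) =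
        (\<integral>w. Q w * (indicator ({..b} \<times> {..d}) w * psi M k1 k2 q w) \<partial>lborel)"
      using dens[OF order_refl order_refl continuous_on_psi[OF pos]]
      by (simp add: Lambda_def case_prod_unfold)
    also have "\<dots> = (\<integral>w. Q w * psi M k1 k2 q w \<partial>lborel)"
    proof (rule Bochner_Integration.integral_cong[OF refl])
      fix w
      show "Q w * (indicator ({..b} \<times> {..d}) w * psi M k1 k2 q w) = Q w * psi M k1 k2 q w"
        using supp[of w] by (cases "w \<in> ?R") (auto simp: indicator_def)
    qed
    also have "\<dots> = (\<integral>v. indicator ?R v *
        ((fst v + k1) powr (q - real (Suc M)) * (snd v - k2) powr (q - real (Suc M))) * kernel v \<partial>lborel)"
      by (rule integral_psi[OF k1 k2])
    also have "\<dots> = (\<integral>v. k v * exp (q * L v) \<partial>lborel)"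
    proof (rule Bochner_Integration.integral_cong[OF refl])
      fix v
      show "indicator ?R v * ((fst v + k1) powr (q - real (Suc M)) * (snd v - k2) powr (q - real (Suc M))) * kernel v
        = k v * exp (q * L v)"
      proof (cases "v \<in> ?R")
        case True
        then have "fst v + k1 > 0" "snd v - k2 > 0" using k1[of "fst v"] k2[of "snd v"] by auto
        then have "exp (q * ln ((fst v + k1) * (snd v - k2))) = (fst v + k1) powr q * (snd v - k2) powr q"
          by (simp add: powr_def ln_mult distrib_left exp_add)
        moreover have "x powr (q - real (Suc M)) = x powr (- real (Suc M)) * x powr q" for x :: real
          unfolding powr_add[symmetric] by (rule arg_cong[of _ _ "(powr) x"]) simp
        ultimately show ?thesis using True by (simp only: k_def L_def indicator_simps mult_1 mult_ac)
      qed (simp add: k_def)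
    qed
    finally show "Lambda a b c d P (psi M k1 k2 q) = (\<integral>v. k v * exp (q * L v) \<partial>lborel)" .
  qed
  then show thesis by (rule that)
qed

theorem theorem6p6:
  fixes a b c d k1 k2 :: real and M :: nat and P :: "real \<times> real \<Rightarrow> real"
  assumes "a \<le> b" and "c \<le> d"
    and "\<And>y z. y \<in> {a..b} \<Longrightarrow> z \<in> {c..d} \<Longrightarrow> y + k1 > 0 \<and> z - k2 > 0"
    and "set_integrable lebesgue ({a..b} \<times> {c..d}) P"
    and "\<And>i j. i \<in> {0..M} \<Longrightarrow> j \<in> {0..M} \<Longrightarrow>
      iterated_integral a b c d
        (\<lambda>(y, z). P (y, z) * ((b - y) ^ i / fact i) * ((d - z) ^ j / fact j)) = 0"
    and "\<And>j s. j \<in> {0..M} \<Longrightarrow> s \<in> {a..b} \<Longrightarrow>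
      iterated_integral a s c d
        (\<lambda>(y, z). P (y, z) * ((s - y) ^ M / fact M) * ((d - z) ^ j / fact j)) = 0"
    and "\<And>i t. i \<in> {0..M} \<Longrightarrow> t \<in> {c..d} \<Longrightarrow>
      iterated_integral a b c t
        (\<lambda>(y, z). P (y, z) * ((b - y) ^ i / fact i) * ((t - z) ^ M / fact M)) = 0"
    and "\<And>s t. s \<in> {a..b} \<Longrightarrow> t \<in> {c..d} \<Longrightarrow>
      iterated_integral a s c t
        (\<lambda>(y, z). P (y, z) * ((s - y) ^ M / fact M) * ((t - z) ^ M / fact M)) \<ge> 0"
  shows
    "let F = (\<lambda>q. Lambda a b c d P (psi M k1 k2 q)) in
       continuous_on UNIV F \<and>
       exponentially_convex_on UNIV F \<and>
       ((\<forall>q. F q > 0) \<longrightarrow>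
          log_convex_on UNIV F \<and>
          (\<forall>r s t. r < s \<and> s < t \<longrightarrow>
             F s powr (t - r) \<le> F r powr (t - s) * F t powr (s - r))) \<and>
       (\<forall>(m::nat) (q :: nat \<Rightarrow> real).
          let A = Matrix.mat m m (\<lambda>(i, j). F ((q i + q j) / 2))
          in positive_semidefinite A \<and> Determinant.det A \<ge> 0) \<and>
       (F differentiable_on UNIV \<longrightarrow>
          (\<forall>s t u v. s \<le> u \<and> t \<le> v \<and> F t \<noteq> 0 \<and> F v \<noteq> 0 \<longrightarrow>
             quotient_mean F s t \<le> quotient_mean F u v))"
proof -
  define F where "F = (\<lambda>q. Lambda a b c d P (psi M k1 k2 q))"
  obtain k L B where "exponential_mixture (lborel :: (real \<times> real) measure) k L B F"
    using Lambda_psi_exponential_mixture[OF assms] unfolding F_def by blast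
  then interpret exponential_mixture "lborel :: (real \<times> real) measure" k L B F .
  show ?thesis
    unfolding Let_def F_def[symmetric]
    using continuous_F exponentially_convex F_log_convex F_three_points
      positive_semidefinite_F psd_det_nonneg[OF positive_semidefinite_F] quotient_mean_mono
    by blast
qed

end
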